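(* Let $R$ be a commutative integral domain with identity and let $\Gamma$ be a discrete group with identity $e$. For $i=1,2$, let $\mathcal{G}_i$ be an ample Hausdorff groupoid and $c_i:\mathcal{G}_i\to\Gamma$ a continuous cocycle such that there is a dense subset $X_i\subseteq\mathcal{G}_i^0$ with the property that the group ring $R\big(c_i^{-1}(e)\cap(\mathcal{G}_i)_x^x\big)$ has no zero-divisors and only trivial units for every $x\in X_i$. Then the following are equivalent: (1) there is an isomorphism of topological groupoids $\psi:\mathcal{G}_1\to\mathcal{G}_2$ with $c_2\circ\psi=c_1$; (2) there is a diagonal-preserving graded $*$-algebra isomorphism $A_R(\mathcal{G}_1)\to A_R(\mathcal{G}_2)$; (3) there is a diagonal-preserving graded ring isomorphism $A_R(\mathcal{G}_1)\to A_R(\mathcal{G}_2)$.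
   Context: $R$ is assumed to carry an involution $r\mapsto r^*$ which is a ring automorphism (possibly the identity). An ample Hausdorff groupoid is a Hausdorff topological groupoid $\mathcal{G}$ whose range and source maps $r(\eta)=\eta\eta^{-1}$, $s(\eta)=\eta^{-1}\eta$ are local homeomorphisms and whose unit space $\mathcal{G}^0$ has a basis of compact open sets. A bisection is a subset $U\subseteq\mathcal{G}$ on which $r$ and $s$ restrict to homeomorphisms onto open subsets of $\mathcal{G}^0$. For $x\in\mathcal{G}^0$, $\mathcal{G}_x^x=\{\eta: s(\eta)=r(\eta)=x\}$ is the isotropy group. A continuous cocycle is a continuous groupoid homomorphism $c:\mathcal{G}\to\Gamma$. The Steinberg algebra $A_R(\mathcal{G})$ is the set of locally constant compactly supported functions $\mathcal{G}\to R$ with pointwise addition and $R$-scaling, convolution product $(f*g)(\eta)=\sum_{\alpha\beta=\eta}f(\alpha)g(\beta)$, and involution $f^*(\eta)=(f(\eta^{-1}))^*$. The diagonal $D_R(\mathcal{G})$ is the commutative subalgebra of $A_R(\mathcal{G})$ consisting of functions supported in the clopen set $\mathcal{G}^0$. A continuous cocycle $c$ induces the $\Gamma$-grading $A_R(\mathcal{G})_g=\{f\in A_R(\mathcal{G}):\operatorname{supp}(f)\subseteq c^{-1}(g)\}$, where $\operatorname{supp}(f)=\{\eta: f(\eta)\neq0\}$. An isomorphism $\phi:A_R(\mathcal{G}_1)\to A_R(\mathcal{G}_2)$ is diagonal-preserving if $\phi(D_R(\mathcal{G}_1))=D_R(\mathcal{G}_2)$ and graded if $\phi(A_R(\mathcal{G}_1)_g)=A_R(\mathcal{G}_2)_g$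 for all $g\in\Gamma$. For a group $H$, the group ring $RH$ "has no zero-divisors and only trivial units" means $ab=0\Rightarrow a=0$ or $b=0$ in $RH$, and every two-sided invertible element of $RH$ has the form $uh$ with $u\in R$, $h\in H$. *)

theory Defs
  imports "HOL-Analysis.Analysis"
begin

text \<open>A groupoid (Renault's axioms) with carrier, set of composable pairs,
partial product, inverse, and a topology on the carrier.\<close>

record 'a tgroupoid =
  gcarrier :: "'a set"
  gcomp    :: "('a \<times> 'a) set"
  gmult    :: "'a \<Rightarrow> 'a \<Rightarrow> 'a"
  ginv     :: "'a \<Rightarrow> 'a"
  gtop     :: "'a topology"

definition groupoid :: "'a tgroupoid \<Rightarrow> bool" where
  "groupoid G \<longleftrightarrow>
     gcomp G \<subseteq> gcarrier G \<times> gcarrier G \<and>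
     (\<forall>a\<in>gcarrier G. ginv G a \<in> gcarrier G \<and> ginv G (ginv G a) = a) \<and>
     (\<forall>a\<in>gcarrier G. (ginv G a, a) \<in> gcomp G) \<and>
     (\<forall>a b. (a, b) \<in> gcomp G \<longrightarrow> gmult G a b \<in> gcarrier G) \<and>
     (\<forall>a b c. (a, b) \<in> gcomp G \<and> (b, c) \<in> gcomp G \<longrightarrow>
        (gmult G a b, c) \<in> gcomp G \<and> (a, gmult G b c) \<in> gcomp G \<and>
        gmult G (gmult G a b) c = gmult G a (gmult G b c)) \<and>
     (\<forall>a b. (a, b) \<in> gcomp G \<longrightarrow>
        gmult G (ginv G a) (gmult G a b) = b \<and> gmult G (gmult G a b) (ginv G b) = a)"

definition grange :: "'a tgroupoid \<Rightarrow> 'a \<Rightarrow> 'a" where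
  "grange G a = gmult G a (ginv G a)"

definition gsource :: "'a tgroupoid \<Rightarrow> 'a \<Rightarrow> 'a" where
  "gsource G a = gmult G (ginv G a) a"

definition gunits :: "'a tgroupoid \<Rightarrow> 'a set" where
  "gunits G = grange G ` gcarrier G"

definition isotropy :: "'a tgroupoid \<Rightarrow> 'a \<Rightarrow> 'a set" where
  "isotropy G x = {\<eta> \<in> gcarrier G. gsource G \<eta> = x \<and> grange G \<eta> = x}"

definition topological_groupoid :: "'a tgroupoid \<Rightarrow> bool" where
  "topological_groupoid G \<longleftrightarrow> groupoid G \<and> topspace (gtop G) = gcarrier G \<and>
     continuous_map (subtopology (prod_topology (gtop G) (gtop G)) (gcomp G)) (gtop G)
        (\<lambda>(a, b). gmult G a b) \<and>
     continuous_map (gtop G) (gtop G) (ginv G)"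

definition local_homeomorphism :: "'a topology \<Rightarrow> 'b topology \<Rightarrow> ('a \<Rightarrow> 'b) \<Rightarrow> bool" where
  "local_homeomorphism X Y f \<longleftrightarrow> continuous_map X Y f \<and>
     (\<forall>x\<in>topspace X. \<exists>U. openin X U \<and> x \<in> U \<and> openin Y (f ` U) \<and>
        homeomorphic_map (subtopology X U) (subtopology Y (f ` U)) f)"

definition ample_Hausdorff_groupoid :: "'a tgroupoid \<Rightarrow> bool" where
  "ample_Hausdorff_groupoid G \<longleftrightarrow> topological_groupoid G \<and> Hausdorff_space (gtop G) \<and>
     local_homeomorphism (gtop G) (subtopology (gtop G) (gunits G)) (grange G) \<and>
     local_homeomorphism (gtop G) (subtopology (gtop G) (gunits G)) (gsource G) \<and>
     (\<forall>W x. openin (subtopology (gtop G) (gunits G)) W \<and> x \<in> W \<longrightarrow>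
        (\<exists>K. compactin (gtop G) K \<and> openin (subtopology (gtop G) (gunits G)) K \<and>
             x \<in> K \<and> K \<subseteq> W))"

definition continuous_cocycle :: "'a tgroupoid \<Rightarrow> ('a \<Rightarrow> 'c::group_add) \<Rightarrow> bool" where
  "continuous_cocycle G c \<longleftrightarrow>
     continuous_map (gtop G) (discrete_topology UNIV) c \<and>
     (\<forall>a b. (a, b) \<in> gcomp G \<longrightarrow> c (gmult G a b) = c a + c b)"

definition steinberg :: "'a tgroupoid \<Rightarrow> ('a \<Rightarrow> 'r::comm_ring_1) set" where
  "steinberg G = {f. (\<forall>x. x \<notin> gcarrier G \<longrightarrow> f x = 0) \<and>
     continuous_map (gtop G) (discrete_topology UNIV) f \<and>
     compactin (gtop G) ((gtop G) closure_of {x \<in> gcarrier G. f x \<noteq> 0})}"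

text \<open>Convolution: sum over all factorisations \<open>\<alpha>\<beta> = \<eta>\<close> (only finitely many nonzero terms).\<close>
definition conv :: "'a tgroupoid \<Rightarrow> ('a \<Rightarrow> 'r::comm_ring_1) \<Rightarrow> ('a \<Rightarrow> 'r) \<Rightarrow> 'a \<Rightarrow> 'r" where
  "conv G f g \<eta> = (\<Sum>(a, b) \<in> {(a, b) \<in> gcomp G. gmult G a b = \<eta> \<and> f a \<noteq> 0 \<and> g b \<noteq> 0}.
                      f a * g b)"

definition sinvol :: "('r \<Rightarrow> 'r) \<Rightarrow> 'a tgroupoid \<Rightarrow> ('a \<Rightarrow> 'r::comm_ring_1) \<Rightarrow> 'a \<Rightarrow> 'r" where
  "sinvol st G f \<eta> = (if \<eta> \<in> gcarrier G then st (f (ginv G \<eta>)) else 0)"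

definition diagonal :: "'a tgroupoid \<Rightarrow> ('a \<Rightarrow> 'r::comm_ring_1) set" where
  "diagonal G = {f \<in> steinberg G. \<forall>x. x \<notin> gunits G \<longrightarrow> f x = 0}"

definition graded_part :: "'a tgroupoid \<Rightarrow> ('a \<Rightarrow> 'c) \<Rightarrow> 'c \<Rightarrow> ('a \<Rightarrow> 'r::comm_ring_1) set" where
  "graded_part G c g = {f \<in> steinberg G. {x. f x \<noteq> 0} \<subseteq> c -` {g}}"

definition ring_involution :: "('r::comm_ring_1 \<Rightarrow> 'r) \<Rightarrow> bool" where
  "ring_involution st \<longleftrightarrow> (\<forall>r. st (st r) = r) \<and> (\<forall>r s. st (r + s) = st r + st s) \<and>
     (\<forall>r s. st (r * s) = st r * st s) \<and> st 1 = 1"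

definition ring_iso :: "'a tgroupoid \<Rightarrow> 'b tgroupoid \<Rightarrow>
    (('a \<Rightarrow> 'r::comm_ring_1) \<Rightarrow> ('b \<Rightarrow> 'r)) \<Rightarrow> bool" where
  "ring_iso G1 G2 \<phi> \<longleftrightarrow> bij_betw \<phi> (steinberg G1) (steinberg G2) \<and>
     (\<forall>f\<in>steinberg G1. \<forall>g\<in>steinberg G1. \<phi> (\<lambda>x. f x + g x) = (\<lambda>y. \<phi> f y + \<phi> g y)) \<and>
     (\<forall>f\<in>steinberg G1. \<forall>g\<in>steinberg G1. \<phi> (conv G1 f g) = conv G2 (\<phi> f) (\<phi> g))"

definition star_algebra_iso :: "('r \<Rightarrow> 'r) \<Rightarrow> 'a tgroupoid \<Rightarrow> 'b tgroupoid \<Rightarrow>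
    (('a \<Rightarrow> 'r::comm_ring_1) \<Rightarrow> ('b \<Rightarrow> 'r)) \<Rightarrow> bool" where
  "star_algebra_iso st G1 G2 \<phi> \<longleftrightarrow> ring_iso G1 G2 \<phi> \<and>
     (\<forall>r. \<forall>f\<in>steinberg G1. \<phi> (\<lambda>x. r * f x) = (\<lambda>y. r * \<phi> f y)) \<and>
     (\<forall>f\<in>steinberg G1. \<phi> (sinvol st G1 f) = sinvol st G2 (\<phi> f))"

definition diagonal_preserving :: "'a tgroupoid \<Rightarrow> 'b tgroupoid \<Rightarrow>
    (('a \<Rightarrow> 'r::comm_ring_1) \<Rightarrow> ('b \<Rightarrow> 'r)) \<Rightarrow> bool" where
  "diagonal_preserving G1 G2 \<phi> \<longleftrightarrow> \<phi> ` diagonal G1 = diagonal G2"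

definition graded_map :: "'a tgroupoid \<Rightarrow> ('a \<Rightarrow> 'c) \<Rightarrow> 'b tgroupoid \<Rightarrow> ('b \<Rightarrow> 'c) \<Rightarrow>
    (('a \<Rightarrow> 'r::comm_ring_1) \<Rightarrow> ('b \<Rightarrow> 'r)) \<Rightarrow> bool" where
  "graded_map G1 c1 G2 c2 \<phi> \<longleftrightarrow> (\<forall>g. \<phi> ` graded_part G1 c1 g = graded_part G2 c2 g)"

definition groupoid_iso :: "'a tgroupoid \<Rightarrow> 'b tgroupoid \<Rightarrow> ('a \<Rightarrow> 'b) \<Rightarrow> bool" where
  "groupoid_iso G1 G2 \<psi> \<longleftrightarrow> bij_betw \<psi> (gcarrier G1) (gcarrier G2) \<and>
     homeomorphic_map (gtop G1) (gtop G2) \<psi> \<and>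
     (\<forall>a\<in>gcarrier G1. \<forall>b\<in>gcarrier G1. (a, b) \<in> gcomp G1 \<longleftrightarrow> (\<psi> a, \<psi> b) \<in> gcomp G2) \<and>
     (\<forall>a b. (a, b) \<in> gcomp G1 \<longrightarrow> \<psi> (gmult G1 a b) = gmult G2 (\<psi> a) (\<psi> b))"

text \<open>The group ring \<open>RH\<close> of a subgroup \<open>H\<close> of the isotropy group at \<open>x\<close>: finitely
supported functions on \<open>H\<close>, with convolution as product and unit \<open>\<delta>_x\<close>.\<close>
definition grpring :: "'r itself \<Rightarrow> 'a set \<Rightarrow> ('a \<Rightarrow> 'r::comm_ring_1) set" where
  "grpring _ H = {a. finite {h. a h \<noteq> 0} \<and> {h. a h \<noteq> 0} \<subseteq> H}"

definition grpring_no_zero_div_trivial_units ::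
    "'r::comm_ring_1 itself \<Rightarrow> 'a tgroupoid \<Rightarrow> 'a set \<Rightarrow> 'a \<Rightarrow> bool" where
  "grpring_no_zero_div_trivial_units T G H x \<longleftrightarrow>
     (\<forall>a\<in>grpring T H. \<forall>b\<in>grpring T H. conv G a b = (\<lambda>_. 0) \<longrightarrow> a = (\<lambda>_. 0) \<or> b = (\<lambda>_. 0)) \<and>
     (\<forall>a\<in>grpring T H.
        (\<exists>b\<in>grpring T H. conv G a b = (\<lambda>k. if k = x then 1 else 0) \<and>
                          conv G b a = (\<lambda>k. if k = x then 1 else 0)) \<longrightarrow>
        (\<exists>u h. h \<in> H \<and> a = (\<lambda>k. if k = h then u else 0)))"

end

(*
  Proof idea for (3) ==> (1).  Call a homogeneous n in A_R(G) a normaliser if Dn = nD (elementwise, in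
  both directions) and there is an m with mn, nm in D and n(mn) = n = (nm)n.  This notion is preserved by
  diagonal-preserving graded ring isomorphisms.  The commutation with D forces any two elements of
  supp(n) with equal source to have equal range, so over a unit x the element n is a translate of a unit
  of the group ring of the degree e isotropy at x.  If that group ring has only trivial units, n has a
  single support point over x; by density and Hausdorffness supp(n) is then a compact open bisection.
  Conversely the indicator function of every homogeneous compact open bisection is a normaliser, so the
  supports of normalisers form a basis of the topology of G.  The isomorphism sends eta in G1 to the
  unique zeta in G2 such that, for all normalisers n, n(eta) is nonzero iff phi(n)(zeta) is nonzero.  Such
  a zeta exists by compactness, the relation is symmetric under passing to the inverse of phi, and
  multiplicativity follows from 1_A * 1_B = 1_{AB}.
*)
theory Submission
  imports Defs
begin

section \<open>Groupoids and their topology\<close>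

text \<open>A map as in (3) need be neither R-linear nor compatible with the involution. Normalisers
  are therefore described by products, the diagonal and the grading alone, not by n D n^*, and
  arrows are matched by comparing where functions vanish, never by their values. The hypothesis on
  group rings is available only over a dense set of units, so the fibre of a normaliser over another
  unit cannot be analysed algebraically. But two support points with a common source would persist
  over an open set of units, since \<open>s\<close> is a local homeomorphism, and that set meets the
  dense one. Homogeneity is what brings in the isotropy of degree e: support points of n over one
  unit then differ only by isotropy elements of that degree. Preservation of D is exploited by
  turning inclusions into equations: if F lies in the bisection E then 1_F = 1_E d with d in D, and
  multiplication by the image of d cannot enlarge a support on the other side. From (1) to (2),
  functions are composed with the inverse of the groupoid isomorphism; (3) is a weakening of
  (2).\<close>

locale gpd =
  fixes G :: "'a tgroupoid"
  assumes groupoid: "groupoid G"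
begin

abbreviation C where "C \<equiv> gcarrier G"
abbreviation s where "s \<equiv> gsource G"
abbreviation r where "r \<equiv> grange G"
abbreviation mult (infixl "\<cdot>" 70) where "a \<cdot> b \<equiv> gmult G a b"
abbreviation inverse_arrow ("\<iota>") where "\<iota> a \<equiv> ginv G a"

lemma comp_carrier: "(a, b) \<in> gcomp G \<Longrightarrow> a \<in> C \<and> b \<in> C \<and> a \<cdot> b \<in> C"
  using groupoid unfolding groupoid_def by blast

lemma inv_carrier [simp]: "a \<in> C \<Longrightarrow> \<iota> a \<in> C"
  and inv_inv [simp]: "a \<in> C \<Longrightarrow> \<iota> (\<iota> a) = a"
  and inv_comp: "a \<in> C \<Longrightarrow> (\<iota> a, a) \<in> gcomp G"
  using groupoid unfolding groupoid_def by simp_all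

lemma comp_inv: "a \<in> C \<Longrightarrow> (a, \<iota> a) \<in> gcomp G"
  using inv_comp[of "\<iota> a"] by simp

lemma assoc:
  assumes "(a, b) \<in> gcomp G" "(b, c) \<in> gcomp G"
  shows "(a \<cdot> b, c) \<in> gcomp G" "(a, b \<cdot> c) \<in> gcomp G" "a \<cdot> b \<cdot> c = a \<cdot> (b \<cdot> c)"
  using assms groupoid unfolding groupoid_def by blast+

lemma cancel:
  assumes "(a, b) \<in> gcomp G"
  shows "\<iota> a \<cdot> (a \<cdot> b) = b" "a \<cdot> b \<cdot> \<iota> b = a"
  using assms groupoid unfolding groupoid_def by blast+

lemma source_inv [simp]: "a \<in> C \<Longrightarrow> s (\<iota> a) = r a"
  and range_inv [simp]: "a \<in> C \<Longrightarrow> r (\<iota> a) = s a"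
  by (auto simp: gsource_def grange_def)

lemma left_unit: "a \<in> C \<Longrightarrow> r a \<cdot> a = a"
  and right_unit: "a \<in> C \<Longrightarrow> a \<cdot> s a = a"
  using cancel[of a "\<iota> a"] cancel[of "\<iota> a" a] comp_inv[of a] inv_comp[of a]
  by (simp_all add: gsource_def grange_def)

text \<open>Renault's axioms take the set of composable pairs as primitive; this recovers it as a
  fibre product. If \<open>(a, b)\<close> is composable, so is
  \<open>(\<iota> a \<cdot> a, b)\<close>, with product \<open>b\<close>, and cancelling
  \<open>b\<close> on the right identifies \<open>s a\<close> with \<open>r b\<close>. Conversely,
  \<open>(a, s a)\<close> and \<open>(r b, b)\<close> are composable and can be glued at the common
  unit.\<close>

lemma comp_iff: "(a, b) \<in> gcomp G \<longleftrightarrow> a \<in> C \<and> b \<in> C \<and> s a = r b"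
proof safe
  assume ab: "(a, b) \<in> gcomp G"
  then show a: "a \<in> C" and b: "b \<in> C" using comp_carrier by auto
  have "(\<iota> a \<cdot> a, b) \<in> gcomp G" "\<iota> a \<cdot> a \<cdot> b = b"
    using assoc[OF inv_comp[OF a] ab] cancel(1)[OF ab] by simp_all
  then show "s a = r b" using cancel(2) by (fastforce simp: gsource_def grange_def)
next
  assume a: "a \<in> C" and b: "b \<in> C" and eq: "s a = r b"
  have "(a, s a) \<in> gcomp G"
    using assoc(2)[OF comp_inv[OF a] inv_comp[OF a]] by (simp add: gsource_def)
  moreover have "(r b, b) \<in> gcomp G"
    using assoc(1)[OF comp_inv[OF b] inv_comp[OF b]] by (simp add: grange_def)
  ultimately have "(a \<cdot> s a, b) \<in> gcomp G" using assoc(1) eq by metis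
  then show "(a, b) \<in> gcomp G" using right_unit[OF a] by simp
qed

lemma mult_carrier: "a \<in> C \<Longrightarrow> b \<in> C \<Longrightarrow> s a = r b \<Longrightarrow> a \<cdot> b \<in> C"
  using comp_carrier comp_iff by blast

text \<open>Associativity makes \<open>(a \<cdot> b, \<iota> b)\<close> composable, and
  \<open>comp_iff\<close> reads the source off from this pair.\<close>

lemma source_mult: "a \<in> C \<Longrightarrow> b \<in> C \<Longrightarrow> s a = r b \<Longrightarrow> s (a \<cdot> b) = s b"
proof -
  assume a: "a \<in> C" and b: "b \<in> C" and "s a = r b"
  then have "(a, b) \<in> gcomp G" by (simp add: comp_iff)
  from assoc(1)[OF this comp_inv[OF b]] show ?thesis using b by (simp add: comp_iff)
qed

lemma range_mult: "a \<in> C \<Longrightarrow> b \<in> C \<Longrightarrow> s a = r b \<Longrightarrow> r (a \<cdot> b) = r a"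
proof -
  assume a: "a \<in> C" and b: "b \<in> C" and "s a = r b"
  then have "(a, b) \<in> gcomp G" by (simp add: comp_iff)
  from assoc(2)[OF inv_comp[OF a] this] show ?thesis using a by (simp add: comp_iff)
qed

lemma mult_assoc:
  "a \<in> C \<Longrightarrow> b \<in> C \<Longrightarrow> c \<in> C \<Longrightarrow> s a = r b \<Longrightarrow> s b = r c \<Longrightarrow> a \<cdot> b \<cdot> c = a \<cdot> (b \<cdot> c)"
  using assoc(3) comp_iff by blast

lemma inv_mult_cancel: "a \<in> C \<Longrightarrow> b \<in> C \<Longrightarrow> s a = r b \<Longrightarrow> \<iota> a \<cdot> (a \<cdot> b) = b"
  and mult_inv_cancel: "a \<in> C \<Longrightarrow> b \<in> C \<Longrightarrow> s a = r b \<Longrightarrow> a \<cdot> b \<cdot> \<iota> b = a"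
  using cancel comp_iff by blast+

lemma mult_inv_cancel': "a \<in> C \<Longrightarrow> b \<in> C \<Longrightarrow> r a = r b \<Longrightarrow> a \<cdot> (\<iota> a \<cdot> b) = b"
  using inv_mult_cancel[of "\<iota> a" b] by simp

lemma inv_mult_cancel': "a \<in> C \<Longrightarrow> b \<in> C \<Longrightarrow> s a = s b \<Longrightarrow> a \<cdot> \<iota> b \<cdot> b = a"
  using mult_inv_cancel[of a "\<iota> b"] by simp

lemma range_carrier [simp]: "a \<in> C \<Longrightarrow> r a \<in> C"
  and source_carrier [simp]: "a \<in> C \<Longrightarrow> s a \<in> C"
  using mult_carrier[of a "\<iota> a"] mult_carrier[of "\<iota> a" a] by (simp_all add: gsource_def grange_def)

lemma range_unit [simp]: "a \<in> C \<Longrightarrow> r a \<in> gunits G"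
  by (simp add: gunits_def)

lemma source_unit [simp]: "a \<in> C \<Longrightarrow> s a \<in> gunits G"
  using range_unit[of "\<iota> a"] by simp

lemma unit_carrier: "x \<in> gunits G \<Longrightarrow> x \<in> C"
  by (auto simp: gunits_def)

lemma range_of_unit: "x \<in> gunits G \<Longrightarrow> r x = x"
proof -
  assume "x \<in> gunits G"
  then obtain a where a: "a \<in> C" "x = r a" by (auto simp: gunits_def)
  then show ?thesis using range_mult[of a "\<iota> a"] a by (simp flip: grange_def[of G a])
qed

lemma source_of_unit: "x \<in> gunits G \<Longrightarrow> s x = x"
proof -
  assume "x \<in> gunits G"
  then obtain a where a: "a \<in> C" "x = r a" by (auto simp: gunits_def)
  then show ?thesis using source_mult[of a "\<iota> a"] a by (simp flip: grange_def[of G a])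
qed

lemma source_range [simp]: "a \<in> C \<Longrightarrow> s (r a) = r a"
  and range_range [simp]: "a \<in> C \<Longrightarrow> r (r a) = r a"
  and source_source [simp]: "a \<in> C \<Longrightarrow> s (s a) = s a"
  and range_source [simp]: "a \<in> C \<Longrightarrow> r (s a) = s a"
  by (simp_all add: source_of_unit range_of_unit)

lemma unit_mult:
  assumes "x \<in> gunits G" "b \<in> C" "s x = r b" shows "x = r b" "x \<cdot> b = b"
  using assms source_of_unit left_unit by auto

lemma mult_unit:
  assumes "x \<in> gunits G" "b \<in> C" "s b = r x" shows "x = s b" "b \<cdot> x = b"
  using assms range_of_unit right_unit by auto

end

section \<open>Local homeomorphisms and the etale topology of an ample groupoid\<close>

lemma local_homeomorphism_open_image:
  assumes f: "local_homeomorphism X Y f" and W: "openin X W"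
  shows "openin Y (f ` W)"
proof (subst openin_subopen, safe)
  fix w assume w: "w \<in> W"
  then have "w \<in> topspace X" using openin_subset[OF W] by blast
  then obtain U where U: "openin X U" "w \<in> U" "openin Y (f ` U)"
    and h: "homeomorphic_map (subtopology X U) (subtopology Y (f ` U)) f"
    using f unfolding local_homeomorphism_def by blast
  have "openin (subtopology X U) (U \<inter> W)"
    using W openin_subtopology_Int2 by blast
  then have "openin (subtopology Y (f ` U)) (f ` (U \<inter> W))"
    using h homeomorphic_imp_open_map open_map_def by blast
  then have "openin Y (f ` (U \<inter> W))" using U(3) openin_trans_full by blast
  then show "\<exists>T. openin Y T \<and> f w \<in> T \<and> T \<subseteq> f ` W" using w U by blast
qed

lemma local_homeomorphism_locally_inj:
  assumes f: "local_homeomorphism X Y f" and x: "x \<in> topspace X"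
  shows "\<exists>U. openin X U \<and> x \<in> U \<and> inj_on f U"
proof -
  obtain U where U: "openin X U" "x \<in> U"
    and h: "homeomorphic_map (subtopology X U) (subtopology Y (f ` U)) f"
    using f x unfolding local_homeomorphism_def by blast
  have "inj_on f U"
    using homeomorphic_imp_injective_map[OF h] U(1) openin_subset
    by (metis inf.absorb2 topspace_subtopology)
  with U show ?thesis by blast
qed

locale ample = gpd G for G :: "'a tgroupoid" +
  assumes ample: "ample_Hausdorff_groupoid G"
begin

abbreviation T where "T \<equiv> gtop G"
abbreviation U0 where "U0 \<equiv> subtopology (gtop G) (gunits G)"

lemma Hausdorff: "Hausdorff_space T"
  and topspace [simp]: "topspace T = C"
  and continuous_inv: "continuous_map T T (ginv G)"
  and continuous_mult: "continuous_map (subtopology (prod_topology T T) (gcomp G)) T (\<lambda>(a, b). a \<cdot> b)"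
  and range_lh: "local_homeomorphism T U0 r"
  and source_lh: "local_homeomorphism T U0 s"
  and unit_basis: "openin U0 W \<Longrightarrow> x \<in> W \<Longrightarrow>
     \<exists>K. compactin T K \<and> openin U0 K \<and> x \<in> K \<and> K \<subseteq> W"
  using ample unfolding ample_Hausdorff_groupoid_def topological_groupoid_def by simp_all

lemma continuous_source: "continuous_map T T s"
  and continuous_range: "continuous_map T T r"
  using source_lh range_lh unfolding local_homeomorphism_def
  by (auto simp: continuous_map_in_subtopology)

lemma carrier_open [simp]: "openin T C"
  using openin_topspace[of T] by simp

lemma open_subset: "openin T W \<Longrightarrow> W \<subseteq> C"
  using openin_subset by fastforce

text \<open>Let \<open>r\<close> be injective on an open \<open>U\<close> around a unit. If both
  \<open>y\<close> and \<open>r y\<close> lie in \<open>U\<close>, then \<open>r (r y) = r y\<close>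
  forces \<open>r y = y\<close>, so \<open>y\<close> is a unit; the points with this property form
  an open set.\<close>

lemma units_open: "openin T (gunits G)"
proof (subst openin_subopen, safe)
  fix x assume x: "x \<in> gunits G"
  obtain U where U: "openin T U" "x \<in> U" "inj_on r U"
    using local_homeomorphism_locally_inj[OF range_lh, of x] x unit_carrier by auto
  let ?V = "U \<inter> {y \<in> topspace T. r y \<in> U}"
  have "openin T ?V" using U continuous_range openin_continuous_map_preimage by blast
  moreover have "x \<in> ?V" using U x range_of_unit unit_carrier by auto
  moreover have "?V \<subseteq> gunits G"
  proof
    fix y assume "y \<in> ?V"
    then have "r y = y" "y \<in> C" using inj_onD[OF U(3), of "r y" y] by auto
    then show "y \<in> gunits G" using range_unit by metis
  qed
  ultimately show "\<exists>V. openin T V \<and> x \<in> V \<and> V \<subseteq> gunits G" by blast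
qed

lemma openin_U0: "openin U0 W \<longleftrightarrow> openin T W \<and> W \<subseteq> gunits G"
  using units_open openin_open_subtopology by blast

lemma source_open: "openin T W \<Longrightarrow> openin T (s ` W)"
  and range_open: "openin T W \<Longrightarrow> openin T (r ` W)"
  using local_homeomorphism_open_image[OF source_lh] local_homeomorphism_open_image[OF range_lh]
  by (auto simp: openin_U0)

lemma compact_closed: "compactin T K \<Longrightarrow> closedin T K"
  using Hausdorff compactin_imp_closedin by blast

text \<open>\<open>K\<close> is covered by finitely many open sets on which \<open>s\<close> is
  injective, and each of them meets the fibre at most once. This keeps convolution sums finite and
  yields finitely supported group ring elements from fibres.\<close>

lemma finite_source_fibre:
  assumes "compactin T K" shows "finite {a \<in> K. s a = x}"
proof -
  let ?F = "{U. openin T U \<and> inj_on s U}"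
  have "K \<subseteq> \<Union>?F"
    using local_homeomorphism_locally_inj[OF source_lh] compactin_subset_topspace[OF assms] by blast
  then obtain F where F: "finite F" "F \<subseteq> ?F" "K \<subseteq> \<Union>F"
    using compactinD[OF assms, of ?F] by blast
  have "finite (\<Union>U\<in>F. {a \<in> U. s a = x})"
  proof (rule finite_UN_I[OF F(1)])
    fix U assume "U \<in> F"
    then have "inj_on s U" using F by blast
    then have "inj_on s {a \<in> U. s a = x}" by (auto simp: inj_on_def)
    moreover have "finite (s ` {a \<in> U. s a = x})" by (rule finite_subset[of _ "{x}"]) auto
    ultimately show "finite {a \<in> U. s a = x}" by (rule finite_imageD[rotated])
  qed
  then show ?thesis by (rule rev_finite_subset) (use F in blast)
qed

end

section \<open>The Steinberg algebra and compact open bisections\<close>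

definition ind :: "'a set \<Rightarrow> 'r::comm_ring_1 \<Rightarrow> 'a \<Rightarrow> 'r" where
  "ind B v = (\<lambda>x. if x \<in> B then v else 0)"

lemma ind_apply: "ind B v x = (if x \<in> B then v else 0)"
  by (simp add: ind_def)

lemma ind_eq_0_iff [simp]: "ind B (1::'r::comm_ring_1) x = 0 \<longleftrightarrow> x \<notin> B"
  by (simp add: ind_apply)

section \<open>Convolution as pure groupoid algebra, before any topology\<close>

context gpd
begin

text \<open>The right factor of any factorisation of \<open>a \<cdot> b\<close> has source
  \<open>s b\<close>, so \<open>uniq\<close> leaves only \<open>b\<close>, and cancellation then
  determines the left factor. This evaluates every convolution whose second function lives on a set
  where \<open>s\<close> is injective.\<close>

lemma conv_at:
  assumes ab: "a \<in> C" "b \<in> C" "s a = r b"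
    and uniq: "\<And>b'. b' \<in> C \<Longrightarrow> g b' \<noteq> 0 \<Longrightarrow> s b' = s b \<Longrightarrow> b' = b"
  shows "conv G f g (a \<cdot> b) = f a * g b"
proof -
  have "a' = a \<and> b' = b" if "(a', b') \<in> gcomp G" "a' \<cdot> b' = a \<cdot> b" "g b' \<noteq> 0" for a' b'
  proof -
    have c: "a' \<in> C" "b' \<in> C" "s a' = r b'" using that comp_iff by auto
    then have "s b' = s b" using source_mult ab that by metis
    then have "b' = b" using uniq c that by blast
    then show ?thesis using mult_inv_cancel ab c that by metis
  qed
  then have "{(a', b') \<in> gcomp G. a' \<cdot> b' = a \<cdot> b \<and> f a' \<noteq> 0 \<and> g b' \<noteq> 0} =
      (if f a \<noteq> 0 \<and> g b \<noteq> 0 then {(a, b)} else {})"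
    using ab comp_iff by auto
  then show ?thesis by (simp add: conv_def)
qed

lemma conv_nonzeroE:
  assumes "conv G f g \<eta> \<noteq> 0"
  obtains a b where "a \<in> C" "b \<in> C" "s a = r b" "a \<cdot> b = \<eta>" "f a \<noteq> 0" "g b \<noteq> 0"
proof -
  have "{(a, b) \<in> gcomp G. a \<cdot> b = \<eta> \<and> f a \<noteq> 0 \<and> g b \<noteq> 0} \<noteq> {}"
    using assms unfolding conv_def by (metis sum.empty)
  then show ?thesis using that comp_iff by blast
qed

lemma conv_outside: "\<eta> \<notin> C \<Longrightarrow> conv G f g \<eta> = 0"
  by (metis conv_nonzeroE mult_carrier)

text \<open>The only factorisation of \<open>\<eta>\<close> that begins with a unit is
  \<open>r \<eta> \<cdot> \<eta>\<close>. The diagonal thus acts by pointwise multiplication through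
  the range, and on the other side through the source, which turns commutation with the diagonal
  into pointwise equations.\<close>

lemma conv_diag_left:
  assumes d: "\<And>x. x \<notin> gunits G \<Longrightarrow> d x = 0" and f: "\<And>x. x \<notin> C \<Longrightarrow> f x = 0"
  shows "conv G d f = (\<lambda>\<eta>. d (r \<eta>) * f \<eta>)"
proof
  fix \<eta> show "conv G d f \<eta> = d (r \<eta>) * f \<eta>"
  proof (cases "\<eta> \<in> C")
    case True
    let ?S = "{(a, b) \<in> gcomp G. a \<cdot> b = \<eta> \<and> d a \<noteq> 0 \<and> f b \<noteq> 0}"
    have "a = r \<eta> \<and> b = \<eta>" if "(a, b) \<in> gcomp G" "a \<cdot> b = \<eta>" "d a \<noteq> 0" for a b
    proof -
      have a: "a \<in> gunits G" and ab: "b \<in> C" "s a = r b" using d that comp_iff by blast+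
      show ?thesis using unit_mult[OF a ab] that(2) by simp
    qed
    moreover have "(r \<eta>, \<eta>) \<in> gcomp G" "r \<eta> \<cdot> \<eta> = \<eta>"
      using True by (simp_all add: comp_iff left_unit)
    ultimately have "?S \<subseteq> {(r \<eta>, \<eta>)}" and "(r \<eta>, \<eta>) \<in> ?S \<longleftrightarrow> d (r \<eta>) \<noteq> 0 \<and> f \<eta> \<noteq> 0"
      by blast+
    then have "?S = (if d (r \<eta>) \<noteq> 0 \<and> f \<eta> \<noteq> 0 then {(r \<eta>, \<eta>)} else {})"
      by (auto dest!: subset_singletonD)
    then show ?thesis by (simp add: conv_def)
  qed (simp add: conv_outside f)
qed

lemma conv_diag_right:
  assumes d: "\<And>x. x \<notin> gunits G \<Longrightarrow> d x = 0" and f: "\<And>x. x \<notin> C \<Longrightarrow> f x = 0"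
  shows "conv G f d = (\<lambda>\<eta>. f \<eta> * d (s \<eta>))"
proof
  fix \<eta> show "conv G f d \<eta> = f \<eta> * d (s \<eta>)"
  proof (cases "\<eta> \<in> C")
    case True
    let ?S = "{(a, b) \<in> gcomp G. a \<cdot> b = \<eta> \<and> f a \<noteq> 0 \<and> d b \<noteq> 0}"
    have "a = \<eta> \<and> b = s \<eta>" if "(a, b) \<in> gcomp G" "a \<cdot> b = \<eta>" "d b \<noteq> 0" for a b
    proof -
      have b: "b \<in> gunits G" and ab: "a \<in> C" "s a = r b" using d that comp_iff by blast+
      show ?thesis using mult_unit[OF b ab] that(2) by simp
    qed
    moreover have "(\<eta>, s \<eta>) \<in> gcomp G" "\<eta> \<cdot> s \<eta> = \<eta>"
      using True by (simp_all add: comp_iff right_unit)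
    ultimately have "?S \<subseteq> {(\<eta>, s \<eta>)}" and "(\<eta>, s \<eta>) \<in> ?S \<longleftrightarrow> f \<eta> \<noteq> 0 \<and> d (s \<eta>) \<noteq> 0"
      by blast+
    then have "?S = (if f \<eta> \<noteq> 0 \<and> d (s \<eta>) \<noteq> 0 then {(\<eta>, s \<eta>)} else {})"
      by (auto dest!: subset_singletonD)
    then show ?thesis by (simp add: conv_def)
  qed (simp add: conv_outside f)
qed

definition set_mult :: "'a set \<Rightarrow> 'a set \<Rightarrow> 'a set" where
  "set_mult A B = {a \<cdot> b | a b. a \<in> A \<and> b \<in> B \<and> s a = r b}"

text \<open>Injectivity of \<open>s\<close> on \<open>B\<close> makes each factorisation unique;
  otherwise the convolution would count factorisations with multiplicity.\<close>

lemma conv_ind: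
  assumes "A \<subseteq> C" "B \<subseteq> C" "inj_on s B"
  shows "conv G (ind A 1) (ind B (1::'r::comm_ring_1)) = ind (set_mult A B) 1"
proof
  fix \<eta> show "conv G (ind A 1) (ind B (1::'r)) \<eta> = ind (set_mult A B) 1 \<eta>"
  proof (cases "\<eta> \<in> set_mult A B")
    case True
    then obtain a b where ab: "\<eta> = a \<cdot> b" "a \<in> A" "b \<in> B" "s a = r b"
      by (auto simp: set_mult_def)
    have "conv G (ind A 1) (ind B (1::'r)) (a \<cdot> b) = ind A 1 a * ind B 1 b"
    proof (rule conv_at)
      fix b' assume "ind B (1::'r) b' \<noteq> 0" "s b' = s b"
      then show "b' = b" using ab assms(3) by (auto simp: ind_apply inj_on_def split: if_splits)
    qed (use ab assms in auto)
    then show ?thesis using ab True by (simp add: ind_apply)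
  next
    case False
    have "conv G (ind A 1) (ind B (1::'r)) \<eta> = 0"
    proof (rule ccontr)
      assume "\<not> ?thesis"
      then obtain a b where "s a = r b" "a \<cdot> b = \<eta>" "ind A (1::'r) a \<noteq> 0" "ind B (1::'r) b \<noteq> 0"
        by (rule conv_nonzeroE)
      then have "\<eta> \<in> set_mult A B" by (auto simp: set_mult_def ind_apply split: if_splits)
      with False show False ..
    qed
    then show ?thesis using False by (simp add: ind_apply)
  qed
qed

text \<open>\<open>\<iota> a\<close> and \<open>b\<close> compose only if \<open>r a = r b\<close>,
  hence only if \<open>a = b\<close>, so every product is of the form
  \<open>\<iota> b \<cdot> b\<close>.\<close>

lemma set_mult_inv_left: "B \<subseteq> C \<Longrightarrow> inj_on r B \<Longrightarrow> set_mult (ginv G ` B) B = s ` B"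
proof (intro equalityI subsetI)
  fix x assume B: "B \<subseteq> C" "inj_on r B" and "x \<in> set_mult (ginv G ` B) B"
  then obtain a b where "x = \<iota> a \<cdot> b" "a \<in> B" "b \<in> B" "s (\<iota> a) = r b" by (auto simp: set_mult_def)
  moreover from this B have "a = b" by (auto simp: inj_on_def subset_iff)
  ultimately show "x \<in> s ` B" by (auto simp: gsource_def)
next
  fix x assume B: "B \<subseteq> C" and "x \<in> s ` B"
  then obtain b where "b \<in> B" "x = \<iota> b \<cdot> b" by (auto simp: gsource_def)
  moreover from this B have "s (\<iota> b) = r b" "\<iota> b \<in> ginv G ` B" by auto
  ultimately show "x \<in> set_mult (ginv G ` B) B" unfolding set_mult_def by blast
qed

lemma set_mult_inv_right: "B \<subseteq> C \<Longrightarrow> inj_on s B \<Longrightarrow> set_mult B (ginv G ` B) = r ` B"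
proof (intro equalityI subsetI)
  fix x assume B: "B \<subseteq> C" "inj_on s B" and "x \<in> set_mult B (ginv G ` B)"
  then obtain a b where "x = a \<cdot> \<iota> b" "a \<in> B" "b \<in> B" "s a = r (\<iota> b)" by (auto simp: set_mult_def)
  moreover from this B have "a = b" by (auto simp: inj_on_def subset_iff)
  ultimately show "x \<in> r ` B" by (auto simp: grange_def)
next
  fix x assume B: "B \<subseteq> C" and "x \<in> r ` B"
  then obtain b where "b \<in> B" "x = b \<cdot> \<iota> b" by (auto simp: grange_def)
  moreover from this B have "s b = r (\<iota> b)" "\<iota> b \<in> ginv G ` B" by auto
  ultimately show "x \<in> set_mult B (ginv G ` B)" unfolding set_mult_def by blast
qed

end

section \<open>Locally constant functions of compact support, and compact open bisections\<close>

context ample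
begin

text \<open>A compact support is closed in a Hausdorff space, so the closure in the definition of
  \<open>steinberg\<close> adds nothing. Open level sets suffice for continuity, as every preimage
  is a union of them.\<close>

lemma steinbergI:
  assumes out: "\<And>x. x \<notin> C \<Longrightarrow> f x = 0"
    and level: "\<And>v. openin T {x \<in> C. f x = v}" and supp: "compactin T {x. f x \<noteq> 0}"
  shows "f \<in> steinberg G"
proof -
  have "openin T {x \<in> C. f x \<in> V}" for V
  proof -
    have "{x \<in> C. f x \<in> V} = (\<Union>v\<in>V. {x \<in> C. f x = v})" by blast
    also have "openin T \<dots>" by (rule openin_Union) (use level in auto)
    finally show ?thesis .
  qed
  then have "continuous_map T (discrete_topology UNIV) f" by (simp add: continuous_map_def)
  moreover have "{x \<in> C. f x \<noteq> 0} = {x. f x \<noteq> 0}" using out by auto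
  moreover have "T closure_of {x. f x \<noteq> 0} = {x. f x \<noteq> 0}"
    by (simp add: closure_of_eq compact_closed[OF supp])
  ultimately show ?thesis using out supp by (simp add: steinberg_def)
qed

lemma steinberg_outside: "f \<in> steinberg G \<Longrightarrow> x \<notin> C \<Longrightarrow> f x = 0"
  by (simp add: steinberg_def)

lemma steinberg_preimage_open:
  assumes "f \<in> steinberg G" shows "openin T {x \<in> C. f x \<in> V}"
proof -
  have "continuous_map T (discrete_topology UNIV) f" using assms by (simp add: steinberg_def)
  from openin_continuous_map_preimage[OF this, of V] show ?thesis by simp
qed

lemma steinberg_level_open:
  assumes "f \<in> steinberg G" shows "openin T {x \<in> C. f x = v}"
  using steinberg_preimage_open[OF assms, of "{v}"] by simp

text \<open>Continuity into a discrete ring makes the zero set open as well, so the support is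
  clopen and coincides with the closure whose compactness is required.\<close>

lemma steinberg_supp:
  assumes f: "f \<in> steinberg G"
  shows "openin T {x. f x \<noteq> 0}" "compactin T {x. f x \<noteq> 0}"
proof -
  have eq: "{x \<in> C. f x \<noteq> 0} = {x. f x \<noteq> 0}" using steinberg_outside[OF f] by auto
  show "openin T {x. f x \<noteq> 0}"
    using steinberg_preimage_open[OF f, of "-{0}"] eq by simp
  have "closedin T {x \<in> C. f x \<noteq> 0}"
  proof -
    have "C - {x \<in> C. f x \<noteq> 0} = {x \<in> C. f x = 0}" by blast
    then show ?thesis using steinberg_level_open[OF f, of 0] by (auto simp: closedin_def)
  qed
  then have "T closure_of {x \<in> C. f x \<noteq> 0} = {x. f x \<noteq> 0}"
    by (simp add: closure_of_eq eq)
  then show "compactin T {x. f x \<noteq> 0}" using f by (simp add: steinberg_def)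
qed

lemma ind_steinberg:
  assumes "openin T B" "compactin T B" shows "ind B v \<in> steinberg G"
proof (rule steinbergI)
  have B: "B \<subseteq> C" using open_subset assms by blast
  fix w
  have "openin T (C - B)" using compact_closed[OF assms(2)] by (auto simp: closedin_def)
  moreover have "{x \<in> C. ind B v x = w} =
      (if v = w then if w = 0 then C else B else if w = 0 then C - B else {})"
    using B by (auto simp: ind_apply)
  moreover have "openin T C" using openin_topspace[of T] by simp
  ultimately show "openin T {x \<in> C. ind B v x = w}" using assms(1) by simp
next
  have "{x. ind B v x \<noteq> 0} = (if v = 0 then {} else B)" by (auto simp: ind_apply)
  then show "compactin T {x. ind B v x \<noteq> 0}" using assms(2) by simp
next
  fix x assume "x \<notin> C" then show "ind B v x = 0" using open_subset[OF assms(1)] by (auto simp: ind_apply)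
qed

lemma ind_diagonal:
  assumes "openin T B" "compactin T B" "B \<subseteq> gunits G" shows "ind B v \<in> diagonal G"
  using ind_steinberg[OF assms(1,2)] assms(3) by (auto simp: diagonal_def ind_apply)

lemma diagonal_steinberg: "d \<in> diagonal G \<Longrightarrow> d \<in> steinberg G"
  by (simp add: diagonal_def)

lemma diagonal_outside: "d \<in> diagonal G \<Longrightarrow> x \<notin> gunits G \<Longrightarrow> d x = 0"
  by (simp add: diagonal_def)

lemma conv_diagonal:
  assumes "d \<in> diagonal G" "f \<in> steinberg G"
  shows "conv G d f = (\<lambda>\<eta>. d (r \<eta>) * f \<eta>)" "conv G f d = (\<lambda>\<eta>. f \<eta> * d (s \<eta>))"
  using conv_diag_left[of d f] conv_diag_right[of d f] assms diagonal_outside steinberg_outside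
  by blast+

text \<open>Compactness is built in. Openness and injectivity replace the usual demand for
  homeomorphisms onto open sets, because \<open>r\<close> and \<open>s\<close> are continuous open
  maps.\<close>

definition bisection :: "'a set \<Rightarrow> bool" where
  "bisection B \<longleftrightarrow> openin T B \<and> compactin T B \<and> inj_on s B \<and> inj_on r B"

lemma bisectionD:
  assumes "bisection B"
  shows "openin T B" "compactin T B" "inj_on s B" "inj_on r B" "B \<subseteq> C"
  using assms open_subset unfolding bisection_def by auto

text \<open>The preimage of an open \<open>V\<close> under the section is the image under
  \<open>s\<close> of \<open>W \<inter> V\<close>, and \<open>s\<close> is an open map.\<close>

lemma section_continuous:
  assumes "openin T W" "inj_on s W"
  shows "continuous_map (subtopology T (s ` W)) T (inv_into W s)"
  unfolding continuous_map_def
proof (intro conjI allI impI)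
  have W: "W \<subseteq> C" by (rule open_subset[OF assms(1)])
  then show "inv_into W s \<in> topspace (subtopology T (s ` W)) \<rightarrow> topspace T"
    using inv_into_into[of _ s W] by fastforce
  fix V assume "openin T V"
  have "{x \<in> topspace (subtopology T (s ` W)). inv_into W s x \<in> V} = s ` (W \<inter> V)"
    using W assms(2) by (auto simp: inv_into_f_f intro: rev_image_eqI)
  moreover have "openin T (s ` (W \<inter> V))"
    using assms(1) \<open>openin T V\<close> source_open by blast
  ultimately show "openin (subtopology T (s ` W))
      {x \<in> topspace (subtopology T (s ` W)). inv_into W s x \<in> V}"
    using openin_open_subtopology[OF source_open[OF assms(1)]] by auto
qed

lemma bisection_basis:
  assumes W: "openin T W" "\<eta> \<in> W"
  obtains B where "bisection B" "\<eta> \<in> B" "B \<subseteq> W"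
proof -
  have \<eta>: "\<eta> \<in> topspace T" using W openin_subset by blast
  obtain U V where U: "openin T U" "\<eta> \<in> U" "inj_on s U" and V: "openin T V" "\<eta> \<in> V" "inj_on r V"
    using local_homeomorphism_locally_inj[OF source_lh \<eta>]
      local_homeomorphism_locally_inj[OF range_lh \<eta>] by blast
  define P where "P = U \<inter> V \<inter> W"
  have P: "openin T P" "\<eta> \<in> P" "inj_on s P" "inj_on r P" "P \<subseteq> C"
    using U V W open_subset by (auto simp: P_def intro: inj_on_subset)
  have "openin U0 (s ` P)" using source_open[OF P(1)] P(5) by (auto simp: openin_U0)
  then obtain K where K: "compactin T K" "openin U0 K" "s \<eta> \<in> K" "K \<subseteq> s ` P"
    using unit_basis[of "s ` P" "s \<eta>"] P(2) by blast
  \<comment> \<open>A set with two descriptions: as part of a preimage under \<open>s\<close> it is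
    open, as the image of \<open>K\<close> under the continuous section of \<open>s\<close> on
    \<open>P\<close> it is compact.\<close>
  let ?B = "P \<inter> {a \<in> topspace T. s a \<in> K}"
  have "?B = inv_into P s ` K"
  proof (intro equalityI subsetI)
    fix a assume "a \<in> ?B" then show "a \<in> inv_into P s ` K"
      using P(3) by (auto intro!: rev_image_eqI[of "s a"])
  next
    fix a assume "a \<in> inv_into P s ` K"
    then obtain b where "b \<in> P" "a = inv_into P s (s b)" "s b \<in> K" using K(4) by blast
    then show "a \<in> ?B" using P by auto
  qed
  moreover have "compactin T (inv_into P s ` K)"
    using image_compactin[OF _ section_continuous[OF P(1,3)]] K by (simp add: compactin_subtopology)
  moreover have "openin T ?B"
    using P(1) openin_continuous_map_preimage[OF continuous_source] K(2) openin_U0 by blast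
  moreover have "inj_on s ?B" "inj_on r ?B" using P by (auto intro: inj_on_subset)
  moreover have "\<eta> \<in> ?B" "?B \<subseteq> W" using P K \<eta> by (auto simp: P_def)
  ultimately have "bisection ?B" by (simp add: bisection_def)
  then show ?thesis using that \<open>\<eta> \<in> ?B\<close> \<open>?B \<subseteq> W\<close> by blast
qed

lemma bisection_inv:
  assumes "bisection B" shows "bisection (ginv G ` B)"
proof -
  note B = bisectionD[OF assms]
  have "ginv G ` B = {x \<in> topspace T. \<iota> x \<in> B}"
    using B(5) by (auto simp: subset_iff intro: rev_image_eqI)
  then have "openin T (ginv G ` B)"
    using openin_continuous_map_preimage[OF continuous_inv B(1)] by simp
  moreover have "compactin T (ginv G ` B)"
    using image_compactin[OF B(2) continuous_inv] .
  ultimately show ?thesis using B(3-5) by (auto simp: bisection_def inj_on_def subset_iff)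
qed

lemma continuous_mult_compose:
  assumes f: "continuous_map X T f" and g: "continuous_map X T g"
    and fg: "\<And>x. x \<in> topspace X \<Longrightarrow> s (f x) = r (g x)"
  shows "continuous_map X T (\<lambda>x. f x \<cdot> g x)"
proof -
  have "f x \<in> C" "g x \<in> C" if "x \<in> topspace X" for x
    using that f g by (auto simp: continuous_map_def Pi_iff)
  then have "continuous_map X (subtopology (prod_topology T T) (gcomp G)) (\<lambda>x. (f x, g x))"
    using f g fg by (auto simp: continuous_map_in_subtopology continuous_map_pairwise o_def comp_iff)
  from continuous_map_compose[OF this continuous_mult] show ?thesis by (simp add: o_def)
qed

text \<open>Openness and compactness come from opposite descriptions of the product set. It is the
  preimage of \<open>A\<close> under the map that divides \<open>q\<close> by the point of
  \<open>B\<close> over \<open>s q\<close>, hence open. It is also the image of a closed part of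
  \<open>B\<close> under the map that multiplies \<open>q\<close> by the point of \<open>A\<close>
  over \<open>r q\<close>, hence compact.\<close>

lemma bisection_mult:
  assumes "bisection A" "bisection B" shows "bisection (set_mult A B)"
proof -
  note A = bisectionD[OF assms(1)] and B = bisectionD[OF assms(2)]
  note [simp] = inv_into_f_f[OF A(3)] inv_into_f_f[OF B(3)]
  have sub: "set_mult A B \<subseteq> C" using A(5) B(5) mult_carrier by (auto simp: set_mult_def)
  \<comment> \<open>The point of \<open>W\<close> with source \<open>f q\<close>, as a continuous
    function of \<open>q\<close>; used with \<open>f = s\<close> on \<open>B\<close> and with
    \<open>f = r\<close> on \<open>A\<close>.\<close>
  have sec: "continuous_map (subtopology T {q \<in> C. f q \<in> s ` W}) T (\<lambda>q. inv_into W s (f q))"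
    if "bisection W" "continuous_map T T f" for W f
  proof -
    have "continuous_map (subtopology T {q \<in> C. f q \<in> s ` W}) (subtopology T (s ` W)) f"
      using that(2) continuous_map_from_subtopology by (auto simp: continuous_map_in_subtopology)
    from continuous_map_compose[OF this section_continuous] show ?thesis
      using bisectionD[OF that(1)] by (simp add: o_def)
  qed
  have "openin T (set_mult A B)"
  proof -
    let ?Q = "{q \<in> C. s q \<in> s ` B}"
    let ?h = "\<lambda>q. q \<cdot> \<iota> (inv_into B s (s q))"
    have Q: "openin T ?Q"
      using openin_continuous_map_preimage[OF continuous_source source_open[OF B(1)]] by simp
    have 1: "continuous_map (subtopology T ?Q) T (\<lambda>q. \<iota> (inv_into B s (s q)))"
      using continuous_map_compose[OF sec[OF assms(2) continuous_source] continuous_inv]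
      by (simp add: o_def)
    have h: "continuous_map (subtopology T ?Q) T ?h"
    proof (rule continuous_mult_compose[OF _ 1])
      fix q assume "q \<in> topspace (subtopology T ?Q)"
      then obtain b where "b \<in> B" "s q = s b" by auto
      then show "s q = r (\<iota> (inv_into B s (s q)))" using B(5) by auto
    qed (simp add: continuous_map_from_subtopology)
    have top: "topspace (subtopology T ?Q) = ?Q" by auto
    from openin_continuous_map_preimage[OF h A(1)]
    have "openin T {q \<in> ?Q. ?h q \<in> A}"
      unfolding top using openin_trans_full[OF _ Q] by blast
    moreover have "{q \<in> ?Q. ?h q \<in> A} = set_mult A B"
    proof (intro equalityI subsetI)
      fix q assume q: "q \<in> {q \<in> ?Q. ?h q \<in> A}"
      then obtain b where b: "b \<in> B" "s q = s b" by blast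
      then have "q \<cdot> \<iota> b \<in> A" "q = q \<cdot> \<iota> b \<cdot> b" "s (q \<cdot> \<iota> b) = r b"
        using q B(5) inv_mult_cancel'[of q b] source_mult[of q "\<iota> b"] by auto
      then show "q \<in> set_mult A B" using b unfolding set_mult_def by blast
    next
      fix q assume "q \<in> set_mult A B"
      then obtain a b where ab: "q = a \<cdot> b" "a \<in> A" "b \<in> B" "s a = r b" by (auto simp: set_mult_def)
      then have "a \<in> C" "b \<in> C" using A(5) B(5) by auto
      then have "q \<in> C" "s q = s b" "q \<cdot> \<iota> b = a"
        using ab source_mult mult_inv_cancel mult_carrier by simp_all
      then show "q \<in> {q \<in> ?Q. ?h q \<in> A}" using ab by simp
    qed
    ultimately show ?thesis by simp
  qed
  moreover have "compactin T (set_mult A B)"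
  proof -
    let ?Q = "{q \<in> C. r q \<in> s ` A}"
    let ?h = "\<lambda>q. inv_into A s (r q) \<cdot> q"
    have "closedin T ?Q"
      using closedin_continuous_map_preimage[OF continuous_range]
        compact_closed[OF image_compactin[OF A(2) continuous_source]] by simp
    then have "compactin T (B \<inter> ?Q)" using B(2) compact_Int_closedin by blast
    moreover have "continuous_map (subtopology T ?Q) T ?h"
    proof (rule continuous_mult_compose[OF sec[OF assms(1) continuous_range]])
      fix q assume "q \<in> topspace (subtopology T ?Q)"
      then obtain a where "a \<in> A" "r q = s a" by auto
      then show "s (inv_into A s (r q)) = r q" using A(5) by auto
    qed (simp add: continuous_map_from_subtopology)
    moreover have "compactin (subtopology T ?Q) (B \<inter> ?Q)"
      using calculation(1) by (simp add: compactin_subtopology)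
    ultimately have "compactin T (?h ` (B \<inter> ?Q))"
      using image_compactin by blast
    moreover have "?h ` (B \<inter> ?Q) = set_mult A B"
    proof (intro equalityI subsetI)
      fix q assume "q \<in> ?h ` (B \<inter> ?Q)"
      then obtain a b where "a \<in> A" "b \<in> B" "r b = s a" "q = inv_into A s (s a) \<cdot> b" by auto
      then show "q \<in> set_mult A B" unfolding set_mult_def by force
    next
      fix q assume "q \<in> set_mult A B"
      then obtain a b where "q = a \<cdot> b" "a \<in> A" "b \<in> B" "s a = r b" by (auto simp: set_mult_def)
      then have "b \<in> B \<inter> ?Q" "q = ?h b" using B(5) by (auto simp flip: \<open>s a = r b\<close>)
      then show "q \<in> ?h ` (B \<inter> ?Q)" by blast
    qed
    ultimately show ?thesis by simp
  qed
  moreover have "inj_on s (set_mult A B)"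
  proof (rule inj_onI)
    fix x y assume "x \<in> set_mult A B" "y \<in> set_mult A B" and eq: "s x = s y"
    then obtain a b a' b' where x: "x = a \<cdot> b" "a \<in> A" "b \<in> B" "s a = r b"
      and y: "y = a' \<cdot> b'" "a' \<in> A" "b' \<in> B" "s a' = r b'"
      unfolding set_mult_def by blast
    then have "b = b'" using eq A(5) B(3,5) source_mult by (metis inj_onD subsetD)
    then have "a = a'" using x y A(3) inj_onD by metis
    then show "x = y" using x y \<open>b = b'\<close> by simp
  qed
  moreover have "inj_on r (set_mult A B)"
  proof (rule inj_onI)
    fix x y assume "x \<in> set_mult A B" "y \<in> set_mult A B" and eq: "r x = r y"
    then obtain a b a' b' where x: "x = a \<cdot> b" "a \<in> A" "b \<in> B" "s a = r b"
      and y: "y = a' \<cdot> b'" "a' \<in> A" "b' \<in> B" "s a' = r b'"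
      unfolding set_mult_def by blast
    then have "a = a'" using eq B(5) A(4,5) range_mult by (metis inj_onD subsetD)
    then have "b = b'" using x y B(4) inj_onD by metis
    then show "x = y" using x y \<open>a = a'\<close> by simp
  qed
  ultimately show ?thesis by (simp add: bisection_def)
qed

end

section \<open>Normalisers of the diagonal\<close>

locale graded_ample = ample G for G :: "'a tgroupoid" +
  fixes c :: "'a \<Rightarrow> 'c::group_add"
  assumes cocycle: "continuous_cocycle G c"
begin

lemma c_mult: "a \<in> C \<Longrightarrow> b \<in> C \<Longrightarrow> s a = r b \<Longrightarrow> c (a \<cdot> b) = c a + c b"
  using cocycle comp_iff unfolding continuous_cocycle_def by blast

lemma c_level_open: "openin T {x \<in> C. c x = g}"
proof -
  have "continuous_map T (discrete_topology UNIV) c"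
    using cocycle by (simp add: continuous_cocycle_def)
  from openin_continuous_map_preimage[OF this, of "{g}"] show ?thesis by simp
qed

lemma c_unit: "x \<in> gunits G \<Longrightarrow> c x = 0"
  using c_mult[of x x] unit_carrier[of x] source_of_unit[of x] range_of_unit[of x]
    right_unit[of x] add_left_cancel[of "c x" "c x" 0] by simp

lemma c_inv: "a \<in> C \<Longrightarrow> c (\<iota> a) = - c a"
  using c_mult[of "\<iota> a" a] c_unit[of "s a"]
  by (simp add: gsource_def[symmetric] eq_neg_iff_add_eq_0)

text \<open>Every product occurring here has a factor in the diagonal or is itself required to lie in it, so
  that associativity of the convolution is never needed. The element \<open>m\<close> plays the role of an inverse
  and need not be homogeneous.\<close>
definition normaliser :: "('a \<Rightarrow> 'r::comm_ring_1) \<Rightarrow> bool" where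
  "normaliser n \<longleftrightarrow> (\<exists>g. n \<in> graded_part G c g) \<and>
     (\<forall>d\<in>diagonal G. \<exists>d'\<in>diagonal G. conv G d n = conv G n d') \<and>
     (\<forall>d\<in>diagonal G. \<exists>d'\<in>diagonal G. conv G n d = conv G d' n) \<and>
     (\<exists>m\<in>steinberg G. conv G m n \<in> diagonal G \<and> conv G n m \<in> diagonal G \<and>
        conv G n (conv G m n) = n \<and> conv G (conv G n m) n = n)"

lemma normaliser_steinberg: "normaliser n \<Longrightarrow> n \<in> steinberg G"
  by (auto simp: normaliser_def graded_part_def)

lemma normaliser_degree: "normaliser n \<Longrightarrow> n a \<noteq> 0 \<Longrightarrow> n b \<noteq> 0 \<Longrightarrow> c a = c b"
  by (auto simp: normaliser_def graded_part_def)

text \<open>With \<open>p = s\<close> and \<open>q = r\<close> this conjugates \<open>d\<close> by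
  the bisection \<open>B\<close>, with the roles exchanged by its inverse; leaving \<open>p\<close>
  and \<open>q\<close> open lets one argument serve both commutation conditions of a normaliser.
  Injectivity of \<open>p\<close> makes the transported function well defined, and it is extended by
  0.\<close>

lemma diagonal_transport:
  assumes B: "openin T B" "compactin T B" and pq: "p = s \<or> p = r" "q = s \<or> q = r"
    and inj: "inj_on p B" and d: "d \<in> diagonal G"
  obtains d' where "d' \<in> diagonal G" "\<And>b. b \<in> B \<Longrightarrow> d' (p b) = d (q b)"
proof -
  have BC: "B \<subseteq> C" using B open_subset by blast
  have p: "continuous_map T T p" "\<And>W. openin T W \<Longrightarrow> openin T (p ` W)" "\<And>a. a \<in> C \<Longrightarrow> p a \<in> gunits G"
    using pq(1) continuous_source continuous_range source_open range_open by auto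
  have q: "continuous_map T T q" "\<And>a. a \<in> C \<Longrightarrow> q a \<in> C"
    using pq(2) continuous_source continuous_range by auto
  define d' where "d' x = (if x \<in> p ` B then d (q (inv_into B p x)) else 0)" for x
  have d'_eq: "d' (p b) = d (q b)" if "b \<in> B" for b
    using that inj by (simp add: d'_def)
  have supp: "{x. d' x \<noteq> 0} = p ` (B \<inter> {b \<in> C. q b \<in> {x. d x \<noteq> 0}})"
  proof (intro equalityI subsetI)
    fix x assume x: "x \<in> {x. d' x \<noteq> 0}"
    then obtain b where "b \<in> B" "x = p b" by (auto simp: d'_def split: if_splits)
    then show "x \<in> p ` (B \<inter> {b \<in> C. q b \<in> {x. d x \<noteq> 0}})" using x d'_eq[of b] BC by auto
  qed (use d'_eq in auto)
  have "d' \<in> steinberg G"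
  proof (rule steinbergI)
    fix v
    have "{b \<in> C. q b \<in> {x \<in> C. d x = v}} = {b \<in> C. d (q b) = v}" using q(2) by auto
    then have op: "openin T (p ` (B \<inter> {b \<in> C. d (q b) = v}))"
      using openin_continuous_map_preimage[OF q(1) steinberg_level_open[OF diagonal_steinberg[OF d], of v]]
      by (intro p(2) openin_Int B(1)) simp
    have closed: "closedin T (p ` B)" using image_compactin[OF B(2) p(1)] by (rule compact_closed)
    \<comment> \<open>The value 0 also collects everything off the image of \<open>B\<close> under
      \<open>p\<close>. That part is open because the image is compact, hence closed.\<close>
    have "{x \<in> C. d' x = v} = p ` (B \<inter> {b \<in> C. d (q b) = v}) \<union> (if v = 0 then C - p ` B else {})"
    proof (intro equalityI subsetI)
      fix x assume x: "x \<in> {x \<in> C. d' x = v}"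
      show "x \<in> p ` (B \<inter> {b \<in> C. d (q b) = v}) \<union> (if v = 0 then C - p ` B else {})"
      proof (cases "x \<in> p ` B")
        case True
        then obtain b where "b \<in> B" "x = p b" by blast
        then show ?thesis using x d'_eq[of b] BC by auto
      next
        case False
        then show ?thesis using x by (auto simp: d'_def)
      qed
    next
      fix x assume x: "x \<in> p ` (B \<inter> {b \<in> C. d (q b) = v}) \<union> (if v = 0 then C - p ` B else {})"
      show "x \<in> {x \<in> C. d' x = v}"
      proof (cases "x \<in> p ` B")
        case True
        then obtain b where "b \<in> B" "x = p b" "b \<in> C" "d (q b) = v" using x by (auto split: if_splits)
        then show ?thesis using d'_eq[of b] p(3)[of b] unit_carrier by auto
      next
        case False
        then show ?thesis using x by (auto simp: d'_def split: if_splits)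
      qed
    qed
    then show "openin T {x \<in> C. d' x = v}" using op closed by (auto simp: closedin_def)
  next
    have "closedin T {x. d x \<noteq> 0}"
      using steinberg_supp(2)[OF diagonal_steinberg[OF d]] by (rule compact_closed)
    from closedin_continuous_map_preimage[OF q(1) this]
    have "closedin T {b \<in> C. q b \<in> {x. d x \<noteq> 0}}" by simp
    then show "compactin T {x. d' x \<noteq> 0}"
      unfolding supp using B(2) p(1) image_compactin compact_Int_closedin by blast
  next
    fix x assume "x \<notin> C"
    then show "d' x = 0" using BC p(3) unit_carrier by (auto simp: d'_def)
  qed
  moreover have "d' x = 0" if "x \<notin> gunits G" for x
    using that BC p(3) by (auto simp: d'_def)
  ultimately have "d' \<in> diagonal G" by (simp add: diagonal_def)
  then show ?thesis using d'_eq that by blast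
qed

text \<open>The witness for \<open>m\<close> is the indicator of the inverse bisection: its products
  with \<open>ind B 1\<close> are the indicators of the sources and of the ranges of
  \<open>B\<close>, which act as one-sided identities on \<open>ind B 1\<close>. The commutation
  conditions are \<open>diagonal_transport\<close> in its two directions.\<close>

lemma ind_normaliser:
  assumes B: "bisection B" and deg: "\<And>b. b \<in> B \<Longrightarrow> c b = g"
  shows "normaliser (ind B (1::'r::comm_ring_1))"
  unfolding normaliser_def
proof (intro conjI ballI)
  note B' = bisectionD[OF B]
  let ?n = "ind B (1::'r)"
  have n: "?n \<in> steinberg G" using ind_steinberg B' by blast
  then show "\<exists>g. ?n \<in> graded_part G c g"
    using deg by (auto simp: graded_part_def ind_apply intro!: exI[of _ g])
  show "\<exists>d'\<in>diagonal G. conv G d ?n = conv G ?n d'" if d: "d \<in> diagonal G" for d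
  proof -
    obtain d' where d': "d' \<in> diagonal G" "\<And>b. b \<in> B \<Longrightarrow> d' (s b) = d (r b)"
      using diagonal_transport[of B s r d] B' d by blast
    have "conv G d ?n = conv G ?n d'"
      unfolding conv_diagonal(1)[OF d n] conv_diagonal(2)[OF d'(1) n]
      using d'(2) by (auto simp: ind_apply)
    then show ?thesis using d' by blast
  qed
  show "\<exists>d'\<in>diagonal G. conv G ?n d = conv G d' ?n" if d: "d \<in> diagonal G" for d
  proof -
    obtain d' where d': "d' \<in> diagonal G" "\<And>b. b \<in> B \<Longrightarrow> d' (r b) = d (s b)"
      using diagonal_transport[of B r s d] B' d by blast
    have "conv G ?n d = conv G d' ?n"
      unfolding conv_diagonal(2)[OF d n] conv_diagonal(1)[OF d'(1) n]
      using d'(2) by (auto simp: ind_apply)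
    then show ?thesis using d' by blast
  qed
  let ?m = "ind (ginv G ` B) (1::'r)"
  note I = bisectionD[OF bisection_inv[OF B]]
  have mn: "conv G ?m ?n = ind (s ` B) 1" and nm: "conv G ?n ?m = ind (r ` B) 1"
    using conv_ind[OF I(5) B'(5,3)] conv_ind[OF B'(5) I(5,3)]
      set_mult_inv_left[OF B'(5,4)] set_mult_inv_right[OF B'(5,3)] by simp_all
  have "s ` B \<subseteq> gunits G" "r ` B \<subseteq> gunits G" using B'(5) by auto
  then have diag: "ind (s ` B) (1::'r) \<in> diagonal G" "ind (r ` B) (1::'r) \<in> diagonal G"
    using ind_diagonal[OF source_open[OF B'(1)] image_compactin[OF B'(2) continuous_source]]
      ind_diagonal[OF range_open[OF B'(1)] image_compactin[OF B'(2) continuous_range]] by simp_all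
  have "conv G ?n (ind (s ` B) 1) = ?n" "conv G (ind (r ` B) 1) ?n = ?n"
    unfolding conv_diagonal(2)[OF diag(1) n] conv_diagonal(1)[OF diag(2) n]
    by (auto simp: ind_apply)
  then show "\<exists>m\<in>steinberg G. conv G m ?n \<in> diagonal G \<and> conv G ?n m \<in> diagonal G \<and>
        conv G ?n (conv G m ?n) = ?n \<and> conv G (conv G ?n m) ?n = ?n"
    using mn nm diag ind_steinberg[OF I(1,2)] by (intro bexI[of _ ?m]) simp_all
qed

lemma unit_separation:
  assumes "x \<in> gunits G" "x \<noteq> y"
  obtains d :: "'a \<Rightarrow> 'r::comm_ring_1" where "d \<in> diagonal G" "d x = 1" "d y = 0"
proof -
  have "openin T (gunits G - {y})"
  proof (cases "y \<in> C")
    case True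
    then have "closedin T {y}" using Hausdorff by (simp add: closedin_Hausdorff_singleton)
    then show ?thesis using units_open by (simp add: openin_diff)
  next
    case False
    then have "gunits G - {y} = gunits G" using unit_carrier by auto
    then show ?thesis using units_open by simp
  qed
  then obtain B where B: "bisection B" "x \<in> B" "B \<subseteq> gunits G - {y}"
    using bisection_basis assms by blast
  then have "ind B (1::'r) \<in> diagonal G" using bisectionD(1,2)[OF B(1)] by (intro ind_diagonal) auto
  moreover have "ind B (1::'r) x = 1" "ind B (1::'r) y = 0" using B by (auto simp: ind_apply)
  ultimately show ?thesis by (rule that)
qed

text \<open>Commutation gives \<open>d (r \<xi>) * n \<xi> = n \<xi> * d' (s \<xi>)\<close>
  everywhere. In an integral domain \<open>n \<xi>\<close> cancels on the support, so there
  \<open>d (r \<xi>)\<close> depends on \<open>s \<xi>\<close> alone; a \<open>d\<close> separating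
  two ranges over one source is therefore impossible. The converse is symmetric.\<close>

lemma normaliser_source_eq_iff:
  fixes n :: "'a \<Rightarrow> 'r::idom"
  assumes n: "normaliser n" and \<eta>: "n \<eta> \<noteq> 0" "n \<eta>' \<noteq> 0"
  shows "s \<eta> = s \<eta>' \<longleftrightarrow> r \<eta> = r \<eta>'"
proof -
  note st = normaliser_steinberg[OF n]
  have C: "\<eta> \<in> C" using \<eta> steinberg_outside[OF st] by blast
  have "r \<eta> = r \<eta>'" if "s \<eta> = s \<eta>'"
  proof (rule ccontr)
    assume "r \<eta> \<noteq> r \<eta>'"
    then obtain d :: "'a \<Rightarrow> 'r" where d: "d \<in> diagonal G" "d (r \<eta>) = 1" "d (r \<eta>') = 0"
      using unit_separation C range_unit by metis
    then obtain d' where d': "d' \<in> diagonal G" "conv G d n = conv G n d'"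
      using n unfolding normaliser_def by blast
    have "d (r \<xi>) * n \<xi> = n \<xi> * d' (s \<xi>)" for \<xi>
      using d'(2) conv_diagonal(1)[OF d(1) st] conv_diagonal(2)[OF d'(1) st] by metis
    from this[of \<eta>] this[of \<eta>'] show False using that d \<eta> by simp
  qed
  moreover have "s \<eta> = s \<eta>'" if "r \<eta> = r \<eta>'"
  proof (rule ccontr)
    assume "s \<eta> \<noteq> s \<eta>'"
    then obtain d :: "'a \<Rightarrow> 'r" where d: "d \<in> diagonal G" "d (s \<eta>) = 1" "d (s \<eta>') = 0"
      using unit_separation C source_unit by metis
    then obtain d' where d': "d' \<in> diagonal G" "conv G n d = conv G d' n"
      using n unfolding normaliser_def by blast
    have "n \<xi> * d (s \<xi>) = d' (r \<xi>) * n \<xi>" for \<xi>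
      using d'(2) conv_diagonal(2)[OF d(1) st] conv_diagonal(1)[OF d'(1) st] by metis
    from this[of \<eta>] this[of \<eta>'] show False using that d \<eta> by simp
  qed
  ultimately show ?thesis by blast
qed

end

text \<open>The parameter \<open>R\<close> only carries the coefficient type, which neither
  \<open>G\<close> nor \<open>c\<close> mentions.\<close>

locale trivial_units = graded_ample G c
  for G :: "'a tgroupoid" and c :: "'a \<Rightarrow> 'c::group_add" +
  fixes R :: "'r::idom itself"
  assumes dense_trivial_units:
    "\<exists>X. X \<subseteq> gunits G \<and> U0 closure_of X = gunits G \<and>
       (\<forall>x\<in>X. grpring_no_zero_div_trivial_units R G (c -` {0} \<inter> isotropy G x) x)"
begin

text \<open>All support points of \<open>n\<close> over \<open>x\<close> share the range
  \<open>r \<gamma>\<close> and the degree \<open>c \<gamma>\<close>, so dividing by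
  \<open>\<gamma>\<close> on the left moves the whole fibre into the degree 0 isotropy at
  \<open>x\<close>. A trivial unit of the group ring has at most one support point, while
  \<open>\<gamma>\<close> and \<open>\<gamma>'\<close> contribute the points \<open>x\<close> and
  \<open>\<iota> \<gamma> \<cdot> \<gamma>'\<close>.\<close>

lemma normaliser_source_unique:
  fixes n :: "'a \<Rightarrow> 'r"
  assumes n: "normaliser n" and x: "x \<in> gunits G"
    and triv: "grpring_no_zero_div_trivial_units R G (c -` {0} \<inter> isotropy G x) x"
    and \<gamma>: "n \<gamma> \<noteq> 0" "s \<gamma> = x" and \<gamma>': "n \<gamma>' \<noteq> 0" "s \<gamma>' = x"
  shows "\<gamma>' = \<gamma>"
proof -
  define H where "H = c -` {0} \<inter> isotropy G x"
  have H: "h \<in> H \<longleftrightarrow> h \<in> C \<and> s h = x \<and> r h = x \<and> c h = 0" for h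
    by (auto simp: H_def isotropy_def)
  note st = normaliser_steinberg[OF n]
  obtain m where m: "m \<in> steinberg G" and mn: "conv G m n \<in> diagonal G" and nm: "conv G n m \<in> diagonal G"
    and n_mn: "conv G n (conv G m n) = n" and nm_n: "conv G (conv G n m) n = n"
    using n unfolding normaliser_def by blast
  have C: "\<beta> \<in> C" if "n \<beta> \<noteq> 0" for \<beta> using that steinberg_outside[OF st] by blast
  have \<gamma>C: "\<gamma> \<in> C" "r (\<iota> \<gamma>) = x" using C \<gamma> by auto
  define y where "y = r \<gamma>"
  have y: "y \<in> gunits G" "y \<in> C" using \<gamma>C by (auto simp: y_def)
  have nr: "r \<beta> = y" "c \<beta> = c \<gamma>" if "n \<beta> \<noteq> 0" "s \<beta> = x" for \<beta>
    using normaliser_source_eq_iff[OF n that(1) \<gamma>(1)] normaliser_degree[OF n that(1) \<gamma>(1)] that \<gamma>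
    by (simp_all add: y_def)
  have ns: "s \<beta> = x" "c \<beta> = c \<gamma>" if "n \<beta> \<noteq> 0" "r \<beta> = y" for \<beta>
    using normaliser_source_eq_iff[OF n that(1) \<gamma>(1)] normaliser_degree[OF n that(1) \<gamma>(1)] that \<gamma>
    by (simp_all add: y_def)
  \<comment> \<open>Both equations for \<open>m\<close> are evaluated at \<open>\<gamma>\<close>,
    where the nonzero value \<open>n \<gamma>\<close> cancels: the diagonal products take the value
    1 at the source \<open>x\<close> and at the range \<open>y\<close>.\<close>
  have "n \<gamma> * conv G m n x = n \<gamma>"
    using n_mn conv_diagonal(2)[OF mn st] \<gamma> by metis
  then have mn1: "conv G m n x = 1" using \<gamma> by simp
  have "conv G n m y * n \<gamma> = n \<gamma>"
    using nm_n conv_diagonal(1)[OF nm st] by (metis y_def)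
  then have nm1: "conv G n m y = 1" using \<gamma> by simp
  \<comment> \<open>Translating the fibre of \<open>n\<close> over \<open>x\<close> by \<open>\<gamma>\<close> gives a unit \<open>a\<close> of the group ring of \<open>H\<close>, with inverse \<open>b\<close>.\<close>
  define a where "a h = (if h \<in> H then n (\<gamma> \<cdot> h) else 0)" for h
  define b where "b h = (if h \<in> H then m (h \<cdot> \<iota> \<gamma>) else 0)" for h
  have xH: "x \<in> H" using x unit_carrier source_of_unit range_of_unit c_unit by (auto simp: H)
  have HH: "h \<cdot> h' \<in> H" if "h \<in> H" "h' \<in> H" for h h'
    using that by (auto simp: H mult_carrier source_mult range_mult c_mult)
  \<comment> \<open>Here and in the next three facts: left division by \<open>\<gamma>\<close>
    matches the arrows from \<open>x\<close> to \<open>y\<close> of degree \<open>c \<gamma>\<close>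
    with \<open>H\<close>, and right multiplication by \<open>\<gamma>\<close> matches the arrows
    from \<open>y\<close> to \<open>x\<close> of degree \<open>- c \<gamma>\<close> with
    \<open>H\<close>.\<close>
  have Hn: "\<iota> \<gamma> \<cdot> \<beta> \<in> H" "\<gamma> \<cdot> (\<iota> \<gamma> \<cdot> \<beta>) = \<beta>" if "\<beta> \<in> C" "s \<beta> = x" "r \<beta> = y" "c \<beta> = c \<gamma>" for \<beta>
    using that \<gamma>C \<gamma>(2) mult_inv_cancel'[of \<gamma> \<beta>]
    by (auto simp: H y_def mult_carrier source_mult range_mult c_mult c_inv)
  have Hm: "\<alpha> \<cdot> \<gamma> \<in> H" "\<alpha> \<cdot> \<gamma> \<cdot> \<iota> \<gamma> = \<alpha>" if "\<alpha> \<in> C" "s \<alpha> = y" "r \<alpha> = x" "c \<alpha> = - c \<gamma>" for \<alpha>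
    using that \<gamma>C \<gamma>(2) mult_inv_cancel[of \<alpha> \<gamma>]
    by (auto simp: H y_def mult_carrier source_mult range_mult c_mult)
  have \<gamma>H: "\<gamma> \<cdot> h \<in> C" "s (\<gamma> \<cdot> h) = x" "r (\<gamma> \<cdot> h) = y" "\<iota> \<gamma> \<cdot> (\<gamma> \<cdot> h) = h" if "h \<in> H" for h
    using that \<gamma>C \<gamma>(2) by (auto simp: H y_def mult_carrier source_mult range_mult inv_mult_cancel)
  have H\<gamma>: "h \<cdot> \<iota> \<gamma> \<in> C" "s (h \<cdot> \<iota> \<gamma>) = y" "r (h \<cdot> \<iota> \<gamma>) = x" "h \<cdot> \<iota> \<gamma> \<cdot> \<gamma> = h" if "h \<in> H" for h
    using that \<gamma>C \<gamma>(2) by (auto simp: H y_def mult_carrier source_mult range_mult inv_mult_cancel')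
  have a: "a \<in> grpring R H"
  proof -
    have "{h. a h \<noteq> 0} \<subseteq> (\<lambda>\<beta>. \<iota> \<gamma> \<cdot> \<beta>) ` {\<beta> \<in> {\<beta>. n \<beta> \<noteq> 0}. s \<beta> = x}"
    proof
      fix h assume "h \<in> {h. a h \<noteq> 0}"
      then have "h \<in> H" "n (\<gamma> \<cdot> h) \<noteq> 0" by (auto simp: a_def split: if_splits)
      then show "h \<in> (\<lambda>\<beta>. \<iota> \<gamma> \<cdot> \<beta>) ` {\<beta> \<in> {\<beta>. n \<beta> \<noteq> 0}. s \<beta> = x}"
        using \<gamma>H[of h] by (intro image_eqI[of _ _ "\<gamma> \<cdot> h"]) auto
    qed
    then have "finite {h. a h \<noteq> 0}"
      using finite_source_fibre[OF steinberg_supp(2)[OF st], of x] finite_surj by blast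
    then show ?thesis by (auto simp: grpring_def a_def)
  qed
  have b: "b \<in> grpring R H"
  proof -
    have "{h. b h \<noteq> 0} \<subseteq> (\<lambda>\<alpha>. \<alpha> \<cdot> \<gamma>) ` {\<alpha> \<in> {\<alpha>. m \<alpha> \<noteq> 0}. s \<alpha> = y}"
    proof
      fix h assume "h \<in> {h. b h \<noteq> 0}"
      then have "h \<in> H" "m (h \<cdot> \<iota> \<gamma>) \<noteq> 0" by (auto simp: b_def split: if_splits)
      then show "h \<in> (\<lambda>\<alpha>. \<alpha> \<cdot> \<gamma>) ` {\<alpha> \<in> {\<alpha>. m \<alpha> \<noteq> 0}. s \<alpha> = y}"
        using H\<gamma>[of h] by (intro image_eqI[of _ _ "h \<cdot> \<iota> \<gamma>"]) auto
    qed
    then have "finite {h. b h \<noteq> 0}"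
      using finite_source_fibre[OF steinberg_supp(2)[OF m], of y] finite_surj by blast
    then show ?thesis by (auto simp: grpring_def b_def)
  qed
  \<comment> \<open>The group ring product is the convolution over all of \<open>G\<close>; it stays
    inside \<open>H\<close> because \<open>H\<close> is closed under multiplication.\<close>
  have out: "conv G f g k = 0" if "f \<in> grpring R H" "g \<in> grpring R H" "k \<notin> H" for f g k
  proof (rule ccontr)
    assume "conv G f g k \<noteq> 0"
    then obtain h h' where "h \<cdot> h' = k" "f h \<noteq> 0" "g h' \<noteq> 0" by (rule conv_nonzeroE)
    then have "h \<in> H" "h' \<in> H" using that(1,2) by (auto simp: grpring_def)
    then show False using HH \<open>h \<cdot> h' = k\<close> that(3) by blast
  qed
  have ba: "conv G b a = (\<lambda>k. if k = x then 1 else 0)"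
  proof
    fix k show "conv G b a k = (if k = x then 1 else 0)"
    proof (cases "k \<in> H")
      case True
      \<comment> \<open>Inserting \<open>\<iota> \<gamma> \<cdot> \<gamma>\<close> between the two
        factors does not change the product \<open>k\<close>, so factorisations in \<open>H\<close>
        match those contributing to the product of \<open>m\<close> and \<open>n\<close>.\<close>
      have "conv G b a k = conv G m n k" unfolding conv_def
      proof (rule sum.reindex_bij_witness[where j = "\<lambda>(h', h). (h' \<cdot> \<iota> \<gamma>, \<gamma> \<cdot> h)"
            and i = "\<lambda>(\<alpha>, \<beta>). (\<alpha> \<cdot> \<gamma>, \<iota> \<gamma> \<cdot> \<beta>)"])
        fix p assume "p \<in> {(h', h) \<in> gcomp G. h' \<cdot> h = k \<and> b h' \<noteq> 0 \<and> a h \<noteq> 0}"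
        then obtain h' h where p: "p = (h', h)" "h' \<cdot> h = k" "h' \<in> H" "h \<in> H"
          "m (h' \<cdot> \<iota> \<gamma>) \<noteq> 0" "n (\<gamma> \<cdot> h) \<noteq> 0" by (auto simp: a_def b_def split: if_splits)
        show "(case case p of (h', h) \<Rightarrow> (h' \<cdot> \<iota> \<gamma>, \<gamma> \<cdot> h) of (\<alpha>, \<beta>) \<Rightarrow> (\<alpha> \<cdot> \<gamma>, \<iota> \<gamma> \<cdot> \<beta>)) = p"
          using p \<gamma>H H\<gamma> by simp
        show "(case case p of (h', h) \<Rightarrow> (h' \<cdot> \<iota> \<gamma>, \<gamma> \<cdot> h) of (\<alpha>, \<beta>) \<Rightarrow> m \<alpha> * n \<beta>) =
            (case p of (h', h) \<Rightarrow> b h' * a h)"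
          using p by (simp add: a_def b_def)
        have "h' \<cdot> \<iota> \<gamma> \<cdot> (\<gamma> \<cdot> h) = h' \<cdot> \<iota> \<gamma> \<cdot> \<gamma> \<cdot> h"
          using p \<gamma>C \<gamma>(2) H\<gamma>[of h'] by (intro mult_assoc[symmetric]) (auto simp: H y_def)
        also have "\<dots> = k" using p H\<gamma>[of h'] by simp
        finally have "h' \<cdot> \<iota> \<gamma> \<cdot> (\<gamma> \<cdot> h) = k" .
        then show "(case p of (h', h) \<Rightarrow> (h' \<cdot> \<iota> \<gamma>, \<gamma> \<cdot> h)) \<in>
            {(\<alpha>, \<beta>) \<in> gcomp G. \<alpha> \<cdot> \<beta> = k \<and> m \<alpha> \<noteq> 0 \<and> n \<beta> \<noteq> 0}"
          using p H\<gamma>[of h'] \<gamma>H[of h] by (simp add: comp_iff)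
      next
        fix p assume "p \<in> {(\<alpha>, \<beta>) \<in> gcomp G. \<alpha> \<cdot> \<beta> = k \<and> m \<alpha> \<noteq> 0 \<and> n \<beta> \<noteq> 0}"
        then obtain \<alpha> \<beta> where p: "p = (\<alpha>, \<beta>)" "\<alpha> \<in> C" "\<beta> \<in> C" "s \<alpha> = r \<beta>" "\<alpha> \<cdot> \<beta> = k"
          "m \<alpha> \<noteq> 0" "n \<beta> \<noteq> 0" by (auto simp: comp_iff)
        have \<beta>: "s \<beta> = x" using True p source_mult[of \<alpha> \<beta>] by (simp add: H)
        have \<beta>': "r \<beta> = y" "c \<beta> = c \<gamma>" using nr[OF p(7) \<beta>] by auto
        \<comment> \<open>Although \<open>m\<close> need not be homogeneous, \<open>k\<close> has
          degree 0 and \<open>\<beta>\<close> has degree \<open>c \<gamma>\<close>, so only the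
          component of \<open>m\<close> of degree \<open>- c \<gamma>\<close> contributes.\<close>
        have "c \<alpha> + c \<beta> = 0" "r \<alpha> = x" using True p c_mult[of \<alpha> \<beta>] range_mult[of \<alpha> \<beta>] by (simp_all add: H)
        then have \<alpha>: "s \<alpha> = y" "r \<alpha> = x" "c \<alpha> = - c \<gamma>"
          using p \<beta>' by (auto simp: eq_neg_iff_add_eq_0)
        note h = Hn[OF p(3) \<beta> \<beta>'] and h' = Hm[OF p(2) \<alpha>]
        show "(case case p of (\<alpha>, \<beta>) \<Rightarrow> (\<alpha> \<cdot> \<gamma>, \<iota> \<gamma> \<cdot> \<beta>) of (h', h) \<Rightarrow> (h' \<cdot> \<iota> \<gamma>, \<gamma> \<cdot> h)) = p"
          using p h h' by simp
        have "\<alpha> \<cdot> \<gamma> \<cdot> (\<iota> \<gamma> \<cdot> \<beta>) = \<alpha> \<cdot> \<gamma> \<cdot> \<iota> \<gamma> \<cdot> \<beta>"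
          using p \<gamma>C \<gamma>(2) \<alpha> \<beta>' h' by (intro mult_assoc[symmetric]) (auto simp: H y_def)
        also have "\<dots> = k" using h' p by simp
        finally have "\<alpha> \<cdot> \<gamma> \<cdot> (\<iota> \<gamma> \<cdot> \<beta>) = k" .
        then show "(case p of (\<alpha>, \<beta>) \<Rightarrow> (\<alpha> \<cdot> \<gamma>, \<iota> \<gamma> \<cdot> \<beta>)) \<in>
            {(h', h) \<in> gcomp G. h' \<cdot> h = k \<and> b h' \<noteq> 0 \<and> a h \<noteq> 0}"
          using p h h' by (simp add: comp_iff a_def b_def) (simp add: H)
      qed
      also have "\<dots> = (if k = x then 1 else 0)"
      proof (cases "k = x")
        case False
        then have "k \<notin> gunits G" using True source_of_unit by (auto simp: H)
        then show ?thesis using diagonal_outside[OF mn] False by simp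
      qed (simp add: mn1)
      finally show ?thesis .
    next
      case False
      then show ?thesis using out[OF b a] xH by auto
    qed
  qed
  have ab: "conv G a b = (\<lambda>k. if k = x then 1 else 0)"
  proof
    fix k show "conv G a b k = (if k = x then 1 else 0)"
    proof (cases "k \<in> H")
      case True
      \<comment> \<open>In this order the product of \<open>n\<close> and \<open>m\<close> lives
        over the range \<open>y\<close> of \<open>\<gamma>\<close>, so \<open>k\<close> has to be
        conjugated into the isotropy at \<open>y\<close>.\<close>
      define k' where "k' = \<gamma> \<cdot> k \<cdot> \<iota> \<gamma>"
      have k': "k' \<in> C" "s k' = y" "r k' = y" "c k' = 0"
        using True \<gamma>C \<gamma>(2) \<gamma>H[OF True]
        by (auto simp: k'_def H y_def mult_carrier source_mult range_mult c_mult c_inv)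
      have k'\<gamma>: "k' \<cdot> \<gamma> = \<gamma> \<cdot> k"
        using True \<gamma>C \<gamma>(2) \<gamma>H[OF True] inv_mult_cancel'[of "\<gamma> \<cdot> k" \<gamma>] by (auto simp: k'_def)
      have "conv G a b k = conv G n m k'" unfolding conv_def
      proof (rule sum.reindex_bij_witness[where j = "\<lambda>(h, h'). (\<gamma> \<cdot> h, h' \<cdot> \<iota> \<gamma>)"
            and i = "\<lambda>(\<beta>, \<alpha>). (\<iota> \<gamma> \<cdot> \<beta>, \<alpha> \<cdot> \<gamma>)"])
        fix p assume "p \<in> {(h, h') \<in> gcomp G. h \<cdot> h' = k \<and> a h \<noteq> 0 \<and> b h' \<noteq> 0}"
        then obtain h h' where p: "p = (h, h')" "h \<cdot> h' = k" "h' \<in> H" "h \<in> H"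
          "m (h' \<cdot> \<iota> \<gamma>) \<noteq> 0" "n (\<gamma> \<cdot> h) \<noteq> 0" by (auto simp: a_def b_def split: if_splits)
        show "(case case p of (h, h') \<Rightarrow> (\<gamma> \<cdot> h, h' \<cdot> \<iota> \<gamma>) of (\<beta>, \<alpha>) \<Rightarrow> (\<iota> \<gamma> \<cdot> \<beta>, \<alpha> \<cdot> \<gamma>)) = p"
          using p \<gamma>H H\<gamma> by simp
        show "(case case p of (h, h') \<Rightarrow> (\<gamma> \<cdot> h, h' \<cdot> \<iota> \<gamma>) of (\<beta>, \<alpha>) \<Rightarrow> n \<beta> * m \<alpha>) =
            (case p of (h, h') \<Rightarrow> a h * b h')"
          using p by (simp add: a_def b_def)
        have "\<gamma> \<cdot> h \<cdot> (h' \<cdot> \<iota> \<gamma>) = \<gamma> \<cdot> h \<cdot> h' \<cdot> \<iota> \<gamma>"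
          using p \<gamma>C \<gamma>H[of h] by (intro mult_assoc[symmetric]) (auto simp: H)
        also have "\<gamma> \<cdot> h \<cdot> h' = \<gamma> \<cdot> k"
          using p \<gamma>C \<gamma>(2) mult_assoc[of \<gamma> h h'] by (auto simp: H)
        finally have "\<gamma> \<cdot> h \<cdot> (h' \<cdot> \<iota> \<gamma>) = k'" by (simp add: k'_def)
        then show "(case p of (h, h') \<Rightarrow> (\<gamma> \<cdot> h, h' \<cdot> \<iota> \<gamma>)) \<in>
            {(\<beta>, \<alpha>) \<in> gcomp G. \<beta> \<cdot> \<alpha> = k' \<and> n \<beta> \<noteq> 0 \<and> m \<alpha> \<noteq> 0}"
          using p H\<gamma>[of h'] \<gamma>H[of h] by (simp add: comp_iff)
      next
        fix p assume "p \<in> {(\<beta>, \<alpha>) \<in> gcomp G. \<beta> \<cdot> \<alpha> = k' \<and> n \<beta> \<noteq> 0 \<and> m \<alpha> \<noteq> 0}"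
        then obtain \<alpha> \<beta> where p: "p = (\<beta>, \<alpha>)" "\<alpha> \<in> C" "\<beta> \<in> C" "s \<beta> = r \<alpha>" "\<beta> \<cdot> \<alpha> = k'"
          "m \<alpha> \<noteq> 0" "n \<beta> \<noteq> 0" by (auto simp: comp_iff)
        have \<beta>: "r \<beta> = y" using k' p range_mult[of \<beta> \<alpha>] by simp
        have \<beta>': "s \<beta> = x" "c \<beta> = c \<gamma>" using ns[OF p(7) \<beta>] by auto
        have "c \<beta> + c \<alpha> = 0" "s \<alpha> = y" using k' p c_mult[of \<beta> \<alpha>] source_mult[of \<beta> \<alpha>] by simp_all
        then have \<alpha>: "s \<alpha> = y" "r \<alpha> = x" "c \<alpha> = - c \<gamma>"
          using p \<beta>' by (auto simp: neg_eq_iff_add_eq_0[symmetric])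
        note h = Hn[OF p(3) \<beta>'(1) \<beta> \<beta>'(2)] and h' = Hm[OF p(2) \<alpha>]
        show "(case case p of (\<beta>, \<alpha>) \<Rightarrow> (\<iota> \<gamma> \<cdot> \<beta>, \<alpha> \<cdot> \<gamma>) of (h, h') \<Rightarrow> (\<gamma> \<cdot> h, h' \<cdot> \<iota> \<gamma>)) = p"
          using p h h' by simp
        have "\<iota> \<gamma> \<cdot> \<beta> \<cdot> (\<alpha> \<cdot> \<gamma>) = \<iota> \<gamma> \<cdot> (\<beta> \<cdot> (\<alpha> \<cdot> \<gamma>))"
          using p \<gamma>C \<gamma>(2) \<beta> \<beta>' h' by (intro mult_assoc) (auto simp: H y_def)
        also have "\<beta> \<cdot> (\<alpha> \<cdot> \<gamma>) = k' \<cdot> \<gamma>"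
          using p \<gamma>C \<alpha> mult_assoc[of \<beta> \<alpha> \<gamma>] by (auto simp: y_def)
        also have "\<iota> \<gamma> \<cdot> (k' \<cdot> \<gamma>) = k" using k'\<gamma> \<gamma>H[OF True] by simp
        finally have "\<iota> \<gamma> \<cdot> \<beta> \<cdot> (\<alpha> \<cdot> \<gamma>) = k" .
        then show "(case p of (\<beta>, \<alpha>) \<Rightarrow> (\<iota> \<gamma> \<cdot> \<beta>, \<alpha> \<cdot> \<gamma>)) \<in>
            {(h, h') \<in> gcomp G. h \<cdot> h' = k \<and> a h \<noteq> 0 \<and> b h' \<noteq> 0}"
          using p h h' by (simp add: comp_iff a_def b_def) (simp add: H)
      qed
      also have "\<dots> = (if k = x then 1 else 0)"
      proof (cases "k = x")
        case x: True
        then have "k' = \<gamma> \<cdot> \<iota> \<gamma>" using right_unit[OF \<gamma>C(1)] \<gamma>(2) by (simp add: k'_def)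
        then have "k' = y" by (simp add: y_def grange_def)
        then show ?thesis using x nm1 by simp
      next
        case False
        have "k' \<notin> gunits G"
        proof
          assume "k' \<in> gunits G"
          then have "k' = y" using k' source_of_unit by metis
          then have "\<gamma> \<cdot> k = \<gamma>" using k'\<gamma> left_unit[OF \<gamma>C(1)] by (simp add: y_def)
          then have "k = \<iota> \<gamma> \<cdot> \<gamma>" using \<gamma>H[OF True] by simp
          then show False using False \<gamma>(2) by (simp add: gsource_def)
        qed
        then show ?thesis using diagonal_outside[OF nm] False by simp
      qed
      finally show ?thesis .
    next
      case False
      then show ?thesis using out[OF a b] xH by auto
    qed
  qed
  obtain u h0 where "a = (\<lambda>k. if k = h0 then u else 0)"
    using triv a b ab ba unfolding grpring_no_zero_div_trivial_units_def H_def[symmetric] by blast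
  then have single: "h = h'" if "a h \<noteq> 0" "a h' \<noteq> 0" for h h'
    using that by (auto split: if_splits)
  have "a x \<noteq> 0" using xH right_unit[OF \<gamma>C(1)] \<gamma> by (simp add: a_def)
  moreover have "a (\<iota> \<gamma> \<cdot> \<gamma>') \<noteq> 0" and \<gamma>'_eq: "\<gamma> \<cdot> (\<iota> \<gamma> \<cdot> \<gamma>') = \<gamma>'"
    using Hn[OF C[OF \<gamma>'(1)] \<gamma>'(2) nr[OF \<gamma>']] \<gamma>' by (simp_all add: a_def)
  ultimately have "\<iota> \<gamma> \<cdot> \<gamma>' = x" using single by blast
  then show ?thesis using \<gamma>'_eq right_unit[OF \<gamma>C(1)] \<gamma>(2) by simp
qed

text \<open>Two support points with one source lie in disjoint open sets \<open>V\<close> and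
  \<open>W\<close>. The sources of the support inside \<open>V\<close> and inside \<open>W\<close>
  overlap in a nonempty open set of units, which contains a point of the dense set; over that point
  the support would have two elements. Injectivity of \<open>r\<close> follows because sources and
  ranges determine each other on the support.\<close>

lemma normaliser_inj:
  fixes n :: "'a \<Rightarrow> 'r"
  assumes n: "normaliser n"
  shows "inj_on s {x. n x \<noteq> 0}" "inj_on r {x. n x \<noteq> 0}"
proof -
  let ?N = "{x. n x \<noteq> 0}"
  note st = normaliser_steinberg[OF n]
  show inj: "inj_on s ?N"
  proof (intro inj_onI, rule ccontr)
    fix \<eta> \<eta>' assume \<eta>: "\<eta> \<in> ?N" "\<eta>' \<in> ?N" "s \<eta> = s \<eta>'" "\<eta> \<noteq> \<eta>'"
    then have C: "\<eta> \<in> C" "\<eta>' \<in> C" using steinberg_outside[OF st] by blast+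
    then obtain V W where V: "openin T V" "openin T W" "\<eta> \<in> V" "\<eta>' \<in> W" "disjnt V W"
      using Hausdorff \<eta>(4) unfolding Hausdorff_space_def by (metis topspace)
    let ?O = "s ` (V \<inter> ?N) \<inter> s ` (W \<inter> ?N)"
    have "openin T ?O" using V steinberg_supp(1)[OF st] source_open by blast
    moreover have sub: "?O \<subseteq> gunits G" using open_subset[OF V(1)] source_unit by blast
    ultimately have O: "openin U0 ?O" by (simp add: openin_U0)
    obtain X where X: "U0 closure_of X = gunits G"
      "\<forall>x\<in>X. grpring_no_zero_div_trivial_units R G (c -` {0} \<inter> isotropy G x) x"
      using dense_trivial_units by blast
    have "s \<eta> \<in> s ` (V \<inter> ?N)" "s \<eta>' \<in> s ` (W \<inter> ?N)" using \<eta> V by blast+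
    then have "s \<eta> \<in> ?O" using \<eta>(3) by simp
    then have "s \<eta> \<in> U0 closure_of X" using X(1) sub by blast
    then have "\<forall>P. s \<eta> \<in> P \<and> openin U0 P \<longrightarrow> (\<exists>x. x \<in> X \<and> x \<in> P)"
      by (simp add: in_closure_of)
    from this[rule_format, of ?O] obtain x where x: "x \<in> X" "x \<in> ?O"
      using \<open>s \<eta> \<in> ?O\<close> O by auto
    obtain \<gamma> where \<gamma>: "\<gamma> \<in> V" "n \<gamma> \<noteq> 0" "x = s \<gamma>" using x(2) by blast
    obtain \<gamma>' where \<gamma>': "\<gamma>' \<in> W" "n \<gamma>' \<noteq> 0" "x = s \<gamma>'" using x(2) by blast
    have "x \<in> gunits G" using x(2) sub by blast
    then have "\<gamma>' = \<gamma>"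
      using normaliser_source_unique[OF n _ X(2)[rule_format, OF x(1)]] \<gamma> \<gamma>' by simp
    then show False using V(5) \<gamma> \<gamma>' by (auto simp: disjnt_iff)
  qed
  show "inj_on r ?N"
    using inj normaliser_source_eq_iff[OF n] by (auto simp: inj_on_def)
qed

text \<open>A right factor from the diagonal cuts a normaliser down to the indicator of a small
  bisection. Since \<open>n\<close> has no other support point over \<open>s \<eta>\<close>, the
  product of \<open>m\<close> and \<open>n\<close> at \<open>s \<eta>\<close> is just
  \<open>m (\<iota> \<eta>) * n \<eta>\<close>; hence \<open>n \<eta>\<close> is a unit of the ring
  and its inverse \<open>v\<close> normalises the value on \<open>E\<close> to 1.\<close>

lemma normaliser_local_ind:
  fixes n :: "'a \<Rightarrow> 'r"
  assumes n: "normaliser n" and \<eta>: "n \<eta> \<noteq> 0" and W: "openin T W" "\<eta> \<in> W"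
  obtains E d where "normaliser (ind E (1::'r))" "\<eta> \<in> E" "E \<subseteq> W"
    "d \<in> diagonal G" "conv G n d = ind E 1"
proof -
  note st = normaliser_steinberg[OF n] and inj = normaliser_inj(1)[OF n]
  obtain m where m: "m \<in> steinberg G" "conv G m n \<in> diagonal G" "conv G n (conv G m n) = n"
    using n unfolding normaliser_def by blast
  have C: "\<eta> \<in> C" using \<eta> steinberg_outside[OF st] by blast
  define v where "v = m (\<iota> \<eta>)"
  have "n \<eta> * conv G m n (s \<eta>) = n \<eta>"
    using conv_diagonal(2)[OF m(2) st] m(3) by metis
  then have "conv G m n (s \<eta>) = 1" using \<eta> by simp
  moreover have "conv G m n (\<iota> \<eta> \<cdot> \<eta>) = m (\<iota> \<eta>) * n \<eta>"
    by (rule conv_at) (use C \<eta> inj in \<open>auto dest: inj_onD\<close>)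
  ultimately have v: "n \<eta> * v = 1" by (simp add: v_def gsource_def mult.commute)
  \<comment> \<open>Constancy of \<open>n\<close> lets one scalar \<open>v\<close> work on all of
    \<open>E\<close>; constancy of \<open>c\<close> makes the indicator of \<open>E\<close>
    homogeneous.\<close>
  define P where "P = W \<inter> {x \<in> C. c x = c \<eta>} \<inter> {x \<in> C. n x = n \<eta>}"
  have "openin T P" "\<eta> \<in> P"
    using W c_level_open steinberg_level_open[OF st] C by (auto simp: P_def)
  then obtain E where E: "bisection E" "\<eta> \<in> E" "E \<subseteq> P" using bisection_basis by blast
  note E' = bisectionD[OF E(1)]
  have d: "ind (s ` E) v \<in> diagonal G"
    using E' source_open[OF E'(1)] image_compactin[OF E'(2) continuous_source]
    by (intro ind_diagonal) auto
  have "conv G n (ind (s ` E) v) = ind E 1"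
  proof
    fix \<xi>
    have "\<xi> \<in> E" if "n \<xi> \<noteq> 0" "s \<xi> \<in> s ` E"
    proof -
      from that(2) obtain e where "e \<in> E" "s \<xi> = s e" by blast
      moreover have "n e \<noteq> 0" using \<open>e \<in> E\<close> E(3) \<eta> by (auto simp: P_def)
      ultimately show ?thesis using inj_onD[OF inj, of \<xi> e] that(1) by simp
    qed
    moreover have "n \<xi> = n \<eta>" if "\<xi> \<in> E" using that E(3) by (auto simp: P_def)
    ultimately show "conv G n (ind (s ` E) v) \<xi> = ind E 1 \<xi>"
      unfolding conv_diagonal(2)[OF d st] using v by (auto simp: ind_apply)
  qed
  moreover have "normaliser (ind E (1::'r))"
    using ind_normaliser[OF E(1), of "c \<eta>"] E(3) by (auto simp: P_def)
  ultimately show ?thesis using that E d by (auto simp: P_def)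
qed

end

section \<open>Closure of the Steinberg algebra under convolution\<close>

context ample
begin

lemma steinbergI_compact:
  assumes out: "\<And>x. x \<notin> C \<Longrightarrow> f x = 0"
    and level: "\<And>v. openin T {x \<in> C. f x = v}" and K: "compactin T K" "{x. f x \<noteq> 0} \<subseteq> K"
  shows "f \<in> steinberg G"
proof (rule steinbergI[OF out level])
  have "C - {x. f x \<noteq> 0} = {x \<in> C. f x = 0}" "{x. f x \<noteq> 0} \<subseteq> C" using out by blast+
  then have "closedin T {x. f x \<noteq> 0}" using level[of 0] by (simp add: closedin_def)
  then show "compactin T {x. f x \<noteq> 0}" using closed_compactin[OF K] by blast
qed

lemma steinberg_add:
  assumes f: "f \<in> steinberg G" and g: "g \<in> steinberg G"
  shows "(\<lambda>x. f x + g x) \<in> steinberg G"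
proof (rule steinbergI_compact)
  fix v
  have "{x \<in> C. f x + g x = v} = (\<Union>w. {x \<in> C. f x = w} \<inter> {x \<in> C. g x = v - w})"
    by (auto simp: algebra_simps)
  also have "openin T \<dots>"
    by (rule openin_Union) (use steinberg_level_open[OF f] steinberg_level_open[OF g] in auto)
  finally show "openin T {x \<in> C. f x + g x = v}" .
next
  show "compactin T ({x. f x \<noteq> 0} \<union> {x. g x \<noteq> 0})"
    using steinberg_supp(2)[OF f] steinberg_supp(2)[OF g] by (rule compactin_Un)
qed (use steinberg_outside[OF f] steinberg_outside[OF g] in auto)

lemma steinberg_restrict:
  assumes f: "f \<in> steinberg G" and B: "openin T B" "compactin T B"
  shows "(\<lambda>x. if x \<in> B then f x else 0) \<in> steinberg G" (is "?g \<in> _")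
    and "(\<lambda>x. if x \<in> B then 0 else f x) \<in> steinberg G" (is "?h \<in> _")
proof -
  have co: "openin T (C - B)" using compact_closed[OF B(2)] by (auto simp: closedin_def)
  have g: "{x \<in> C. ?g x = v} = B \<inter> {x \<in> C. f x = v} \<union> (if v = 0 then C - B else {})"
    and h: "{x \<in> C. ?h x = v} = (C - B) \<inter> {x \<in> C. f x = v} \<union> (if v = 0 then B else {})" for v
    using open_subset[OF B(1)] by auto
  show "?g \<in> steinberg G"
    by (rule steinbergI_compact[OF _ _ B(2)])
      (use co B(1) steinberg_level_open[OF f] steinberg_outside[OF f] in \<open>auto simp: g\<close>)
  show "?h \<in> steinberg G"
    by (rule steinbergI_compact[OF _ _ steinberg_supp(2)[OF f]])
      (use co B(1) steinberg_level_open[OF f] steinberg_outside[OF f] in \<open>auto simp: h\<close>)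
qed

text \<open>A compact support is covered by finitely many bisections, and restricting to one of them
  and to its complement splits off one summand at a time. Both restrictions stay locally constant
  since a bisection is clopen.\<close>

lemma steinberg_induct [consumes 1, case_names bisection add]:
  assumes f: "f \<in> steinberg G"
    and bis: "\<And>f B. f \<in> steinberg G \<Longrightarrow> bisection B \<Longrightarrow> {x. f x \<noteq> 0} \<subseteq> B \<Longrightarrow> P f"
    and add: "\<And>f g. f \<in> steinberg G \<Longrightarrow> g \<in> steinberg G \<Longrightarrow> P f \<Longrightarrow> P g \<Longrightarrow> P (\<lambda>x. f x + g x)"
  shows "P f"
proof -
  have cover: "P f" if "finite F" "\<forall>B\<in>F. bisection B" "f \<in> steinberg G" "{x. f x \<noteq> 0} \<subseteq> \<Union>F" for F f
    using that
  proof (induction F arbitrary: f rule: finite_induct)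
    case empty
    have "bisection {}" by (simp add: bisection_def)
    then show ?case by (rule bis[OF empty(2)]) (use empty(3) in simp)
  next
    case (insert B F)
    let ?g = "\<lambda>x. if x \<in> B then f x else 0" and ?h = "\<lambda>x. if x \<in> B then 0 else f x"
    have B: "bisection B" using insert.prems(1) by simp
    note g = steinberg_restrict(1)[OF insert.prems(2) bisectionD(1,2)[OF B]]
    note h = steinberg_restrict(2)[OF insert.prems(2) bisectionD(1,2)[OF B]]
    have "P ?g" by (rule bis[OF g B]) auto
    moreover have "P ?h"
    proof (rule insert.IH[OF _ h])
      show "\<forall>B\<in>F. bisection B" using insert.prems(1) by simp
      show "{x. ?h x \<noteq> 0} \<subseteq> \<Union>F" using insert.prems(3) by auto
    qed
    ultimately have "P (\<lambda>x. ?g x + ?h x)" by (rule add[OF g h])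
    moreover have "(\<lambda>x. ?g x + ?h x) = f" by auto
    ultimately show ?case by (simp only:)
  qed
  have "\<exists>F. finite F \<and> F \<subseteq> Collect bisection \<and> {x. f x \<noteq> 0} \<subseteq> \<Union>F"
  proof (rule compactinD[OF steinberg_supp(2)[OF f]])
    show "openin T U" if "U \<in> Collect bisection" for U using that by (simp add: bisection_def)
    show "{x. f x \<noteq> 0} \<subseteq> \<Union>(Collect bisection)"
    proof
      fix x assume "x \<in> {x. f x \<noteq> 0}"
      then obtain B where "bisection B" "x \<in> B"
        using bisection_basis[OF steinberg_supp(1)[OF f]] by metis
      then show "x \<in> \<Union>(Collect bisection)" by blast
    qed
  qed
  then show ?thesis using cover[of _ f] f by blast
qed

text \<open>The sum over factorisations becomes a finite sum over a source fibre of
  \<open>K\<close>, an index set that does not depend on the values of \<open>f\<close> and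
  \<open>g\<close>. This makes additivity a termwise identity.\<close>

lemma conv_fibre_sum:
  assumes f: "f \<in> steinberg G" and g: "g \<in> steinberg G" and K: "{x. g x \<noteq> 0} \<subseteq> K"
    "compactin T K" and \<eta>: "\<eta> \<in> C"
  shows "conv G f g \<eta> = (\<Sum>b\<in>{b \<in> K. s b = s \<eta>}. f (\<eta> \<cdot> \<iota> b) * g b)"
proof -
  have KC: "K \<subseteq> C" using compactin_subset_topspace[OF K(2)] by simp
  have "conv G f g \<eta> = (\<Sum>b\<in>{b \<in> K. s b = s \<eta> \<and> f (\<eta> \<cdot> \<iota> b) \<noteq> 0 \<and> g b \<noteq> 0}. f (\<eta> \<cdot> \<iota> b) * g b)"
    unfolding conv_def
  proof (rule sum.reindex_bij_witness[where j = snd and i = "\<lambda>b. (\<eta> \<cdot> \<iota> b, b)"])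
    fix p assume "p \<in> {(a, b) \<in> gcomp G. a \<cdot> b = \<eta> \<and> f a \<noteq> 0 \<and> g b \<noteq> 0}"
    then obtain a b where p: "p = (a, b)" "a \<in> C" "b \<in> C" "s a = r b" "a \<cdot> b = \<eta>" "f a \<noteq> 0" "g b \<noteq> 0"
      by (auto simp: comp_iff)
    then have eq: "\<eta> \<cdot> \<iota> b = a" "s \<eta> = s b" using mult_inv_cancel source_mult by auto
    then show "(\<eta> \<cdot> \<iota> (snd p), snd p) = p" using p by simp
    show "f (\<eta> \<cdot> \<iota> (snd p)) * g (snd p) = (case p of (a, b) \<Rightarrow> f a * g b)" using p eq by simp
    show "snd p \<in> {b \<in> K. s b = s \<eta> \<and> f (\<eta> \<cdot> \<iota> b) \<noteq> 0 \<and> g b \<noteq> 0}" using p eq K(1) by auto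
  next
    fix b assume b: "b \<in> {b \<in> K. s b = s \<eta> \<and> f (\<eta> \<cdot> \<iota> b) \<noteq> 0 \<and> g b \<noteq> 0}"
    then have "b \<in> C" using KC by blast
    then have "\<eta> \<cdot> \<iota> b \<cdot> b = \<eta>" "s (\<eta> \<cdot> \<iota> b) = r b" "\<eta> \<cdot> \<iota> b \<in> C"
      using b \<eta> inv_mult_cancel'[of \<eta> b] source_mult[of \<eta> "\<iota> b"] mult_carrier[of \<eta> "\<iota> b"] by auto
    then show "(\<eta> \<cdot> \<iota> b, b) \<in> {(a, b) \<in> gcomp G. a \<cdot> b = \<eta> \<and> f a \<noteq> 0 \<and> g b \<noteq> 0}"
      using b \<open>b \<in> C\<close> by (simp add: comp_iff)
  qed simp
  also have "\<dots> = (\<Sum>b\<in>{b \<in> K. s b = s \<eta>}. f (\<eta> \<cdot> \<iota> b) * g b)"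
    by (rule sum.mono_neutral_left) (use finite_source_fibre[OF K(2)] in auto)
  finally show ?thesis .
qed

lemma conv_add:
  assumes f: "f \<in> steinberg G" "f' \<in> steinberg G" and g: "g \<in> steinberg G" "g' \<in> steinberg G"
  shows "conv G (\<lambda>x. f x + f' x) g = (\<lambda>x. conv G f g x + conv G f' g x)"
    and "conv G f (\<lambda>x. g x + g' x) = (\<lambda>x. conv G f g x + conv G f g' x)"
proof -
  show "conv G (\<lambda>x. f x + f' x) g = (\<lambda>x. conv G f g x + conv G f' g x)"
  proof
    fix \<eta> show "conv G (\<lambda>x. f x + f' x) g \<eta> = conv G f g \<eta> + conv G f' g \<eta>"
    proof (cases "\<eta> \<in> C")
      case True
      note eq = conv_fibre_sum[OF _ g(1) order_refl steinberg_supp(2)[OF g(1)] True]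
      show ?thesis
        unfolding eq[OF f(1)] eq[OF f(2)] eq[OF steinberg_add[OF f]]
        by (simp add: algebra_simps sum.distrib)
    qed (simp add: conv_outside)
  qed
  \<comment> \<open>Cancellation may shrink the support of the sum, so the union of the supports
    serves as a common index set for all three convolutions.\<close>
  let ?K = "{x. g x \<noteq> 0} \<union> {x. g' x \<noteq> 0}"
  have K: "compactin T ?K" using compactin_Un steinberg_supp(2) g by blast
  show "conv G f (\<lambda>x. g x + g' x) = (\<lambda>x. conv G f g x + conv G f g' x)"
  proof
    fix \<eta> show "conv G f (\<lambda>x. g x + g' x) \<eta> = conv G f g \<eta> + conv G f g' \<eta>"
    proof (cases "\<eta> \<in> C")
      case True
      note eq = conv_fibre_sum[OF f(1) _ _ K True]
      have "conv G f g \<eta> = (\<Sum>b\<in>{b \<in> ?K. s b = s \<eta>}. f (\<eta> \<cdot> \<iota> b) * g b)"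
        "conv G f g' \<eta> = (\<Sum>b\<in>{b \<in> ?K. s b = s \<eta>}. f (\<eta> \<cdot> \<iota> b) * g' b)"
        "conv G f (\<lambda>x. g x + g' x) \<eta> = (\<Sum>b\<in>{b \<in> ?K. s b = s \<eta>}. f (\<eta> \<cdot> \<iota> b) * (g b + g' b))"
        by (rule eq; use g steinberg_add in auto)+
      then show ?thesis by (simp add: algebra_simps sum.distrib)
    qed (simp add: conv_outside)
  qed
qed

text \<open>On the product bisection the convolution is a product of two single values. Its level
  set at \<open>v\<close> is therefore a union, over the pairs of values with product
  \<open>v\<close>, of products of smaller bisections, together with the open complement when
  \<open>v = 0\<close>.\<close>

lemma steinberg_conv_bisection:
  assumes f: "f \<in> steinberg G" and A: "bisection A" "{x. f x \<noteq> 0} \<subseteq> A"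
    and g: "g \<in> steinberg G" and B: "bisection B" "{x. g x \<noteq> 0} \<subseteq> B"
  shows "conv G f g \<in> steinberg G"
proof -
  note A' = bisectionD[OF A(1)] and B' = bisectionD[OF B(1)]
  have at: "conv G f g (a \<cdot> b) = f a * g b" if ab: "a \<in> A" "b \<in> B" "s a = r b" for a b
  proof (rule conv_at)
    fix b' assume "g b' \<noteq> 0" "s b' = s b"
    then have "b' \<in> B" using B(2) by blast
    then show "b' = b" using inj_onD[OF B'(3) \<open>s b' = s b\<close>] ab by blast
  qed (use ab A' B' in auto)
  have off: "\<eta> \<in> set_mult A B" if "conv G f g \<eta> \<noteq> 0" for \<eta>
  proof -
    from that obtain a b where "a \<cdot> b = \<eta>" "f a \<noteq> 0" "g b \<noteq> 0" "s a = r b" by (rule conv_nonzeroE)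
    moreover from this have "a \<in> A" "b \<in> B" using A(2) B(2) by blast+
    ultimately show ?thesis unfolding set_mult_def by blast
  qed
  have sub: "bisection (D \<inter> {x \<in> C. h x = w})" if D: "bisection D" and h: "h \<in> steinberg G"
    for D w and h :: "'a \<Rightarrow> 'b"
  proof -
    note D' = bisectionD[OF D]
    have "C - {x \<in> C. h x = w} = {x \<in> C. h x \<in> - {w}}" by blast
    then have "closedin T {x \<in> C. h x = w}"
      using steinberg_preimage_open[OF h, of "-{w}"] by (auto simp: closedin_def)
    then show ?thesis
      unfolding bisection_def using D' steinberg_level_open[OF h, of w]
      by (auto intro: compact_Int_closedin inj_on_subset)
  qed
  note AB = bisectionD[OF bisection_mult[OF A(1) B(1)]]
  show ?thesis
  proof (rule steinbergI_compact[OF _ _ AB(2)])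
    fix v
    let ?L = "\<lambda>w. set_mult (A \<inter> {x \<in> C. f x = fst w}) (B \<inter> {x \<in> C. g x = snd w})"
    have op: "openin T (\<Union>w\<in>{w. fst w * snd w = v}. ?L w)"
      using bisectionD(1)[OF bisection_mult[OF sub[OF A(1) f] sub[OF B(1) g]]] by blast
    have co: "openin T (if v = 0 then C - set_mult A B else {})"
      using compact_closed[OF AB(2)] by (auto simp: closedin_def)
    have eq: "{x \<in> C. conv G f g x = v} = (\<Union>w\<in>{w. fst w * snd w = v}. ?L w) \<union>
        (if v = 0 then C - set_mult A B else {})"
    proof (intro equalityI subsetI)
      fix x assume x: "x \<in> {x \<in> C. conv G f g x = v}"
      show "x \<in> (\<Union>w\<in>{w. fst w * snd w = v}. ?L w) \<union> (if v = 0 then C - set_mult A B else {})"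
      proof (cases "x \<in> set_mult A B")
        case True
        then obtain a b where ab: "x = a \<cdot> b" "a \<in> A" "b \<in> B" "s a = r b"
          unfolding set_mult_def by blast
        then have "f a * g b = v" using x at by simp
        moreover have "a \<in> C" "b \<in> C" using ab A' B' by auto
        then have "x \<in> ?L (f a, g b)" using ab unfolding set_mult_def by auto
        ultimately show ?thesis by fastforce
      next
        case False
        then show ?thesis using x off by auto
      qed
    next
      fix x assume x: "x \<in> (\<Union>w\<in>{w. fst w * snd w = v}. ?L w) \<union> (if v = 0 then C - set_mult A B else {})"
      then consider w where "fst w * snd w = v" "x \<in> ?L w" | "v = 0" "x \<in> C - set_mult A B"
        by (auto split: if_splits)
      then show "x \<in> {x \<in> C. conv G f g x = v}"
      proof cases
        case 1
        then obtain a b where "x = a \<cdot> b" "a \<in> A" "b \<in> B" "s a = r b" "f a = fst w" "g b = snd w"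
          unfolding set_mult_def by blast
        moreover from this have "x \<in> C" using A'(5) B'(5) mult_carrier by blast
        ultimately show ?thesis using at 1(1) by simp
      next
        case 2
        then show ?thesis using off by blast
      qed
    qed
    show "openin T {x \<in> C. conv G f g x = v}" unfolding eq using op co by (rule openin_Un)
  qed (use conv_outside off in blast)+
qed

text \<open>Bilinearity reduces both arguments to functions on bisections. The closure is needed to
  see that the inverse of a ring isomorphism is multiplicative.\<close>

lemma steinberg_conv:
  assumes f: "f \<in> steinberg G" and g: "g \<in> steinberg G"
  shows "conv G f g \<in> steinberg G"
  using f
proof (induction rule: steinberg_induct)
  case (bisection f A)
  note f = this
  show ?case using g
  proof (induction rule: steinberg_induct)
    case (bisection g B)
    then show ?case using steinberg_conv_bisection f by blast
  next
    case (add g g')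
    then show ?case using conv_add(2)[OF f(1) f(1) add(1,2)] steinberg_add by simp
  qed
next
  case (add f f')
  then show ?case using conv_add(1)[OF add(1,2) g g] steinberg_add by simp
qed

text \<open>Continuity holds only on the subspace of composable pairs, so the box obtained controls
  just the composable pairs inside it, which is what \<open>set_mult\<close> records.\<close>

lemma mult_neighbourhoods:
  assumes ab: "a \<in> C" "b \<in> C" "s a = r b" and W: "openin T W" "a \<cdot> b \<in> W"
  obtains U V where "openin T U" "openin T V" "a \<in> U" "b \<in> V" "set_mult U V \<subseteq> W"
proof -
  let ?P = "prod_topology T T"
  have "openin (subtopology ?P (gcomp G))
      {p \<in> topspace (subtopology ?P (gcomp G)). (case p of (a, b) \<Rightarrow> a \<cdot> b) \<in> W}"
    by (rule openin_continuous_map_preimage[OF continuous_mult W(1)])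
  then obtain Q where Q: "openin ?P Q"
    "{p \<in> topspace (subtopology ?P (gcomp G)). (case p of (a, b) \<Rightarrow> a \<cdot> b) \<in> W} = Q \<inter> gcomp G"
    unfolding openin_subtopology by blast
  have "(a, b) \<in> {p \<in> topspace (subtopology ?P (gcomp G)). (case p of (a, b) \<Rightarrow> a \<cdot> b) \<in> W}"
    using ab W(2) by (simp add: comp_iff)
  then have "(a, b) \<in> Q" using Q(2) by blast
  from Q(1)[unfolded openin_prod_topology_alt, rule_format, OF this]
  obtain U V where UV: "openin T U" "openin T V" "a \<in> U" "b \<in> V" "U \<times> V \<subseteq> Q"
    by blast
  have "set_mult U V \<subseteq> W"
  proof
    fix x assume "x \<in> set_mult U V"
    then obtain u v where x: "x = u \<cdot> v" "u \<in> U" "v \<in> V" "s u = r v" unfolding set_mult_def by blast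
    then have "(u, v) \<in> Q \<inter> gcomp G"
      using UV(5) open_subset[OF UV(1)] open_subset[OF UV(2)] by (auto simp: comp_iff)
    then show "x \<in> W" unfolding Q(2)[symmetric] using x(1) by simp
  qed
  with UV that show ?thesis by blast
qed

end

context graded_ample
begin

lemma normaliser_basis:
  assumes "openin T W" "\<eta> \<in> W"
  obtains B where "bisection B" "normaliser (ind B (1::'r::comm_ring_1))" "\<eta> \<in> B" "B \<subseteq> W"
proof -
  have "\<eta> \<in> C" using assms open_subset by blast
  then obtain B where B: "bisection B" "\<eta> \<in> B" "B \<subseteq> W \<inter> {x \<in> C. c x = c \<eta>}"
    using bisection_basis[of "W \<inter> {x \<in> C. c x = c \<eta>}" \<eta>] assms c_level_open by blast
  then have "normaliser (ind B (1::'r))" using ind_normaliser[OF B(1), of "c \<eta>"] by blast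
  then show ?thesis using that B by blast
qed

end

section \<open>Reconstruction of the groupoid\<close>

locale diagonal_graded_iso =
  A: trivial_units G1 c1 R + B: trivial_units G2 c2 R
  for G1 :: "'a tgroupoid" and c1 :: "'a \<Rightarrow> 'c::group_add"
    and G2 :: "'b tgroupoid" and c2 :: "'b \<Rightarrow> 'c" and R :: "'r::idom itself" +
  fixes \<phi> :: "('a \<Rightarrow> 'r) \<Rightarrow> 'b \<Rightarrow> 'r"
  assumes iso: "ring_iso G1 G2 \<phi>"
    and diag: "diagonal_preserving G1 G2 \<phi>"
    and graded: "graded_map G1 c1 G2 c2 \<phi>"
begin

section \<open>The isomorphism, its inverse, and transport of normalisers and supports\<close>

definition \<phi>_inv where "\<phi>_inv = inv_into (steinberg G1) \<phi>"

lemma bij: "bij_betw \<phi> (steinberg G1) (steinberg G2)"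
  and add: "f \<in> steinberg G1 \<Longrightarrow> g \<in> steinberg G1 \<Longrightarrow> \<phi> (\<lambda>x. f x + g x) = (\<lambda>y. \<phi> f y + \<phi> g y)"
  and conv: "f \<in> steinberg G1 \<Longrightarrow> g \<in> steinberg G1 \<Longrightarrow> \<phi> (conv G1 f g) = conv G2 (\<phi> f) (\<phi> g)"
  using iso by (simp_all add: ring_iso_def)

lemma in_steinberg: "f \<in> steinberg G1 \<Longrightarrow> \<phi> f \<in> steinberg G2"
  using bij bij_betwE by blast

lemma inv_in_steinberg: "f \<in> steinberg G2 \<Longrightarrow> \<phi>_inv f \<in> steinberg G1"
  and \<phi>_inv_right: "f \<in> steinberg G2 \<Longrightarrow> \<phi> (\<phi>_inv f) = f"
  and \<phi>_inv_left: "h \<in> steinberg G1 \<Longrightarrow> \<phi>_inv (\<phi> h) = h"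
  using bij_betw_apply[OF bij_betw_inv_into[OF bij]] bij_betw_inv_into_right[OF bij]
    bij_betw_inv_into_left[OF bij] by (simp_all add: \<phi>_inv_def)

lemma in_diagonal: "d \<in> diagonal G1 \<Longrightarrow> \<phi> d \<in> diagonal G2"
  using diag unfolding diagonal_preserving_def by blast

lemma in_graded: "f \<in> graded_part G1 c1 g \<Longrightarrow> \<phi> f \<in> graded_part G2 c2 g"
  using graded unfolding graded_map_def by blast

text \<open>\<open>\<phi>_inv\<close> inverts \<open>\<phi>\<close> only on the Steinberg algebras,
  so their closure under sums and convolutions enters. Later proofs interpret this as
  \<open>I\<close> to use each fact in the reverse direction.\<close>

lemma inverse: "diagonal_graded_iso G2 c2 G1 c1 R \<phi>_inv"
proof
  have bij': "bij_betw \<phi>_inv (steinberg G2) (steinberg G1)"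
    unfolding \<phi>_inv_def by (rule bij_betw_inv_into[OF bij])
  have add': "\<phi>_inv (\<lambda>x. f x + g x) = (\<lambda>y. \<phi>_inv f y + \<phi>_inv g y)"
    if f: "f \<in> steinberg G2" and g: "g \<in> steinberg G2" for f g
    using add[OF inv_in_steinberg[OF f] inv_in_steinberg[OF g]]
      \<phi>_inv_left[OF A.steinberg_add[OF inv_in_steinberg[OF f] inv_in_steinberg[OF g]]]
    by (simp add: \<phi>_inv_right f g)
  have conv': "\<phi>_inv (conv G2 f g) = conv G1 (\<phi>_inv f) (\<phi>_inv g)"
    if f: "f \<in> steinberg G2" and g: "g \<in> steinberg G2" for f g
    using conv[OF inv_in_steinberg[OF f] inv_in_steinberg[OF g]]
      \<phi>_inv_left[OF A.steinberg_conv[OF inv_in_steinberg[OF f] inv_in_steinberg[OF g]]]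
    by (simp add: \<phi>_inv_right f g)
  show "ring_iso G2 G1 \<phi>_inv"
    unfolding ring_iso_def using bij' add' conv' by blast
  have image: "\<phi>_inv ` (\<phi> ` S) = S" if "S \<subseteq> steinberg G1" for S
    using that \<phi>_inv_left by (force simp: image_image subset_iff)
  show "diagonal_preserving G2 G1 \<phi>_inv"
    using diag image[of "diagonal G1"] A.diagonal_steinberg
    unfolding diagonal_preserving_def by (metis subsetI)
  show "graded_map G2 c2 G1 c1 \<phi>_inv"
    unfolding graded_map_def
  proof
    fix g
    have "graded_part G1 c1 g \<subseteq> (steinberg G1 :: ('a \<Rightarrow> 'r) set)" by (auto simp: graded_part_def)
    then have "\<phi>_inv ` \<phi> ` graded_part G1 c1 g = graded_part G1 c1 g" by (rule image)
    moreover have "\<phi> ` graded_part G1 c1 g = graded_part G2 c2 g"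
      using graded by (simp add: graded_map_def)
    ultimately show "\<phi>_inv ` graded_part G2 c2 g = graded_part G1 c1 g" by simp
  qed
qed

lemma zero: "\<phi> (\<lambda>_. 0) = (\<lambda>_. 0)"
proof -
  have "(\<lambda>_. 0) \<in> (steinberg G1 :: ('a \<Rightarrow> 'r) set)"
    using A.ind_steinberg[of "{}" "0::'r"] by (simp add: ind_def)
  from add[OF this this] have "\<phi> (\<lambda>_. 0) = (\<lambda>y. \<phi> (\<lambda>_. 0) y + \<phi> (\<lambda>_. 0) y)"
    by (simp only: add_0_left)
  from fun_cong[OF this] show ?thesis by (metis add_cancel_right_right)
qed

lemma normaliser_image:
  assumes n: "A.normaliser n" shows "B.normaliser (\<phi> n)"
  unfolding B.normaliser_def
proof (intro conjI ballI)
  note st = A.normaliser_steinberg[OF n]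
  have diag_onto: "\<exists>e\<in>diagonal G1. d = \<phi> e" if "d \<in> diagonal G2" for d
    using that diag unfolding diagonal_preserving_def by blast
  show "\<exists>g. \<phi> n \<in> graded_part G2 c2 g"
    using n in_graded unfolding A.normaliser_def by blast
  show "\<exists>d'\<in>diagonal G2. conv G2 d (\<phi> n) = conv G2 (\<phi> n) d'" if d: "d \<in> diagonal G2" for d
  proof -
    obtain e where e: "e \<in> diagonal G1" "d = \<phi> e" using diag_onto[OF d] by blast
    then obtain e' where e': "e' \<in> diagonal G1" "conv G1 e n = conv G1 n e'"
      using n unfolding A.normaliser_def by blast
    then have "conv G2 d (\<phi> n) = conv G2 (\<phi> n) (\<phi> e')"
      using conv st e A.diagonal_steinberg by metis
    then show ?thesis using in_diagonal[OF e'(1)] by blast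
  qed
  show "\<exists>d'\<in>diagonal G2. conv G2 (\<phi> n) d = conv G2 d' (\<phi> n)" if d: "d \<in> diagonal G2" for d
  proof -
    obtain e where e: "e \<in> diagonal G1" "d = \<phi> e" using diag_onto[OF d] by blast
    then obtain e' where e': "e' \<in> diagonal G1" "conv G1 n e = conv G1 e' n"
      using n unfolding A.normaliser_def by blast
    then have "conv G2 (\<phi> n) d = conv G2 (\<phi> e') (\<phi> n)"
      using conv st e A.diagonal_steinberg by metis
    then show ?thesis using in_diagonal[OF e'(1)] by blast
  qed
  obtain m where m: "m \<in> steinberg G1" and mn: "conv G1 m n \<in> diagonal G1"
    and nm: "conv G1 n m \<in> diagonal G1" and "conv G1 n (conv G1 m n) = n"
    and "conv G1 (conv G1 n m) n = n"
    using n unfolding A.normaliser_def by blast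
  then have "conv G2 (\<phi> n) (conv G2 (\<phi> m) (\<phi> n)) = \<phi> n"
    "conv G2 (conv G2 (\<phi> n) (\<phi> m)) (\<phi> n) = \<phi> n"
    using conv[OF st A.diagonal_steinberg[OF mn]] conv[OF A.diagonal_steinberg[OF nm] st]
      conv[OF m st] conv[OF st m] by simp_all
  moreover have "conv G2 (\<phi> m) (\<phi> n) \<in> diagonal G2" "conv G2 (\<phi> n) (\<phi> m) \<in> diagonal G2"
    using in_diagonal[OF mn] in_diagonal[OF nm] conv[OF m st] conv[OF st m] by simp_all
  ultimately show "\<exists>m\<in>steinberg G2. conv G2 m (\<phi> n) \<in> diagonal G2 \<and> conv G2 (\<phi> n) m \<in> diagonal G2 \<and>
      conv G2 (\<phi> n) (conv G2 m (\<phi> n)) = \<phi> n \<and> conv G2 (conv G2 (\<phi> n) m) (\<phi> n) = \<phi> n"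
    using in_steinberg[OF m] by blast
qed

text \<open>\<open>\<phi> d\<close> is again diagonal, and right multiplication by it only rescales
  values. This is the sole mechanism by which inclusions of supports pass through
  \<open>\<phi>\<close>.\<close>

lemma conv_diagonal_supp:
  assumes f: "f \<in> steinberg G1" and d: "d \<in> diagonal G1"
  shows "{y. \<phi> (conv G1 f d) y \<noteq> 0} \<subseteq> {y. \<phi> f y \<noteq> 0}"
  unfolding conv[OF f A.diagonal_steinberg[OF d]] B.conv_diagonal(2)[OF in_diagonal[OF d] in_steinberg[OF f]]
  by auto

lemma shrink:
  assumes n: "A.normaliser n" "n \<eta> \<noteq> 0" and W: "openin (gtop G1) W" "\<eta> \<in> W"
  obtains E where "A.normaliser (ind E (1::'r))" "\<eta> \<in> E" "E \<subseteq> W"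
    "{y. \<phi> (ind E 1) y \<noteq> 0} \<subseteq> {y. \<phi> n y \<noteq> 0}"
proof -
  obtain E d where E: "A.normaliser (ind E (1::'r))" "\<eta> \<in> E" "E \<subseteq> W" "d \<in> diagonal G1"
    "conv G1 n d = ind E 1"
    using A.normaliser_local_ind[OF n W] .
  show ?thesis
    using that[OF E(1-3)] conv_diagonal_supp[OF A.normaliser_steinberg[OF n(1)] E(4)] E(5) by simp
qed

text \<open>As \<open>s\<close> is injective on \<open>E\<close>, the indicator of \<open>F\<close>
  is that of \<open>E\<close> times the diagonal indicator of the sources of
  \<open>F\<close>.\<close>

lemma ind_supp_mono:
  assumes E: "A.normaliser (ind E (1::'r))" and F: "A.normaliser (ind F (1::'r))" and "F \<subseteq> E"
  shows "{y. \<phi> (ind F 1) y \<noteq> 0} \<subseteq> {y. \<phi> (ind E 1) y \<noteq> 0}"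
proof -
  have supp: "{x. ind S (1::'r) x \<noteq> 0} = S" for S :: "'a set" by (auto simp: ind_apply)
  note st = A.normaliser_steinberg[OF E]
  note F' = A.steinberg_supp[OF A.normaliser_steinberg[OF F], unfolded supp]
  note inj = A.normaliser_inj(1)[OF E, unfolded supp]
  have d: "ind (A.s ` F) (1::'r) \<in> diagonal G1"
  proof (rule A.ind_diagonal[OF A.source_open[OF F'(1)] image_compactin[OF F'(2) A.continuous_source]])
    show "A.s ` F \<subseteq> gunits G1" using A.open_subset[OF F'(1)] A.source_unit by blast
  qed
  have "conv G1 (ind E 1) (ind (A.s ` F) (1::'r)) = ind F 1"
    unfolding A.conv_diagonal(2)[OF d st]
  proof
    fix x show "ind E 1 x * ind (A.s ` F) 1 (A.s x) = ind F (1::'r) x"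
    proof -
      have "x \<in> F \<longleftrightarrow> x \<in> E \<and> A.s x \<in> A.s ` F"
        using \<open>F \<subseteq> E\<close> inj_on_image_mem_iff[OF inj] by blast
      then show ?thesis by (simp add: ind_apply)
    qed
  qed
  then show ?thesis using conv_diagonal_supp[OF st d] by simp
qed

text \<open>Only vanishing is compared, because \<open>\<phi>\<close> may change the values of a
  normaliser at corresponding arrows.\<close>

definition rel :: "'a \<Rightarrow> 'b \<Rightarrow> bool" where
  "rel \<eta> \<zeta> \<longleftrightarrow> \<eta> \<in> gcarrier G1 \<and> \<zeta> \<in> gcarrier G2 \<and>
     (\<forall>n. A.normaliser n \<longrightarrow> (n \<eta> \<noteq> 0 \<longleftrightarrow> \<phi> n \<zeta> \<noteq> 0))"

lemma rel_total:
  assumes \<eta>: "\<eta> \<in> gcarrier G1"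
  shows "\<exists>\<zeta>. rel \<eta> \<zeta>"
proof -
  interpret I: diagonal_graded_iso G2 c2 G1 c1 R \<phi>_inv by (rule inverse)
  let ?F = "{n. A.normaliser n \<and> n \<eta> \<noteq> 0}"
  let ?S = "\<lambda>n. {y. \<phi> n y \<noteq> 0}"
  \<comment> \<open>The supports of \<open>\<phi> n\<close>, for normalisers \<open>n\<close> not vanishing at \<open>\<eta>\<close>, are compact and downward directed.\<close>
  have below: "\<exists>E. A.normaliser (ind E (1::'r)) \<and> \<eta> \<in> E \<and> (\<forall>n\<in>N. ?S (ind E 1) \<subseteq> ?S n)"
    if "finite N" "N \<subseteq> ?F" for N
    using that
  proof (induction N rule: finite_induct)
    case empty
    obtain E where "A.bisection E" "A.normaliser (ind E (1::'r))" "\<eta> \<in> E" "E \<subseteq> gcarrier G1"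
      using A.normaliser_basis[OF A.carrier_open \<eta>] .
    then show ?case by blast
  next
    case (insert n N)
    then have n: "A.normaliser n" "n \<eta> \<noteq> 0" and "N \<subseteq> ?F" by simp_all
    from insert.IH[OF this(3)]
    obtain E where E: "A.normaliser (ind E (1::'r))" "\<eta> \<in> E" "\<forall>n\<in>N. ?S (ind E 1) \<subseteq> ?S n"
      by blast
    have "{x. ind E (1::'r) x \<noteq> 0} = E" by (auto simp: ind_apply)
    then have "openin (gtop G1) E"
      using A.steinberg_supp(1)[OF A.normaliser_steinberg[OF E(1)]] by simp
    from shrink[OF n this E(2)] obtain E' where
      E': "A.normaliser (ind E' (1::'r))" "\<eta> \<in> E'" "E' \<subseteq> E" "?S (ind E' 1) \<subseteq> ?S n" .
    then have "\<forall>n\<in>insert n N. ?S (ind E' 1) \<subseteq> ?S n"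
      using ind_supp_mono[OF E(1) E'(1,3)] E(3) by blast
    then show ?case using E' by blast
  qed
  have nonzero: "?S (ind E 1) \<noteq> {}" if "A.normaliser (ind E (1::'r))" "\<eta> \<in> E" for E
  proof
    assume "?S (ind E 1) = {}"
    then have "\<phi> (ind E 1) = (\<lambda>_. 0)" by auto
    then have "ind E (1::'r) = (\<lambda>_. 0)"
      using \<phi>_inv_left[OF A.normaliser_steinberg[OF that(1)]] I.zero by simp
    from fun_cong[OF this, of \<eta>] show False using that(2) by (simp add: ind_apply)
  qed
  \<comment> \<open>One fixed compact support, inside which the finite intersection property is
    applied.\<close>
  obtain E0 where E0: "A.normaliser (ind E0 (1::'r))" "\<eta> \<in> E0"
    using below[of "{}"] by auto
  have supp: "compactin (gtop G2) (?S n)" if "A.normaliser n" for n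
    by (rule B.steinberg_supp(2)[OF in_steinberg[OF A.normaliser_steinberg[OF that]]])
  have "?S (ind E0 1) \<inter> \<Inter>(?S ` ?F) \<noteq> {}"
  proof (rule compactin_fip[THEN iffD1, THEN conjunct2, rule_format, OF supp[OF E0(1)], rotated], intro conjI ballI allI impI)
    fix K assume "K \<in> ?S ` ?F"
    then show "closedin (gtop G2) K" using supp B.compact_closed by auto
  next
    fix Z assume "finite Z \<and> Z \<subseteq> ?S ` ?F"
    then have "finite Z" "Z \<subseteq> ?S ` ?F" by simp_all
    from finite_subset_image[OF this] obtain N where N: "finite N" "N \<subseteq> ?F" "Z = ?S ` N" by blast
    have "finite (insert (ind E0 1) N)" "insert (ind E0 1) N \<subseteq> ?F"
      using N E0 by (auto simp: ind_apply)
    from below[OF this] obtain E where E: "A.normaliser (ind E (1::'r))" "\<eta> \<in> E"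
      and le: "\<forall>n\<in>insert (ind E0 1) N. ?S (ind E 1) \<subseteq> ?S n" by blast
    obtain y where "y \<in> ?S (ind E 1)" using nonzero[OF E] by blast
    then have "\<forall>n\<in>insert (ind E0 1) N. y \<in> ?S n" using le by blast
    then have "y \<in> ?S (ind E0 1) \<inter> \<Inter>Z" unfolding N(3) by simp
    then show "?S (ind E0 1) \<inter> \<Inter>Z \<noteq> {}" by blast
  qed
  then obtain \<zeta> where \<zeta>0: "\<zeta> \<in> ?S (ind E0 1)" and \<zeta>: "\<zeta> \<in> \<Inter>(?S ` ?F)" by blast
  have \<zeta>C: "\<zeta> \<in> gcarrier G2"
    using \<zeta>0 B.steinberg_outside[OF in_steinberg[OF A.normaliser_steinberg[OF E0(1)]]] by blast
  \<comment> \<open>If \<open>n\<close> vanished at \<open>\<eta>\<close>, it would vanish on some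
    \<open>E\<close> around \<open>\<eta>\<close>. Both \<open>\<phi> n\<close> and
    \<open>\<phi> (ind E 1)\<close> are nonzero at \<open>\<zeta>\<close>, so some indicator around
    \<open>\<zeta>\<close> pulls back to a function supported in \<open>E\<close> and in the support
    of \<open>n\<close>. These are disjoint, which would make a nonzero indicator vanish.\<close>
  have "n \<eta> \<noteq> 0" if n: "A.normaliser n" and n\<zeta>: "\<phi> n \<zeta> \<noteq> 0" for n
  proof
    assume "n \<eta> = 0"
    let ?W = "{x \<in> gcarrier G1. n x = 0}"
    have "openin (gtop G1) ?W" "\<eta> \<in> ?W"
      using A.steinberg_level_open[OF A.normaliser_steinberg[OF n], of 0] \<open>n \<eta> = 0\<close> \<eta> by auto
    then obtain E where "A.bisection E" and
      E: "A.normaliser (ind E (1::'r))" "\<eta> \<in> E" "E \<subseteq> ?W"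
      by (rule A.normaliser_basis)
    then have "\<phi> (ind E 1) \<zeta> \<noteq> 0" using \<zeta> by (auto simp: ind_apply)
    note E2 = normaliser_image[OF E(1)] and n2 = normaliser_image[OF n]
    have inv: "\<phi>_inv (\<phi> (ind E 1)) = ind E 1" "\<phi>_inv (\<phi> n) = n"
      using \<phi>_inv_left[OF A.normaliser_steinberg[OF E(1)]] \<phi>_inv_left[OF A.normaliser_steinberg[OF n]]
      by simp_all
    from I.shrink[OF n2 n\<zeta> B.carrier_open \<zeta>C, unfolded inv]
    obtain D where D: "B.normaliser (ind D (1::'r))" "\<zeta> \<in> D" "D \<subseteq> gcarrier G2"
      "{y. \<phi>_inv (ind D 1) y \<noteq> 0} \<subseteq> {y. n y \<noteq> 0}" .
    have "{x. ind D (1::'r) x \<noteq> 0} = D" by (auto simp: ind_apply)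
    then have "openin (gtop G2) D"
      using B.steinberg_supp(1)[OF B.normaliser_steinberg[OF D(1)]] by simp
    from I.shrink[OF E2 \<open>\<phi> (ind E 1) \<zeta> \<noteq> 0\<close> this D(2), unfolded inv]
    obtain D' where D': "B.normaliser (ind D' (1::'r))" "\<zeta> \<in> D'" "D' \<subseteq> D"
      "{y. \<phi>_inv (ind D' 1) y \<noteq> 0} \<subseteq> {y. ind E (1::'r) y \<noteq> 0}" .
    have "{y. \<phi>_inv (ind D' 1) y \<noteq> 0} \<subseteq> {y. n y \<noteq> 0} \<inter> E"
      using I.ind_supp_mono[OF D(1) D'(1,3)] D(4) D'(4) by auto
    then have "\<phi>_inv (ind D' 1) = (\<lambda>_. 0)" using E(3) by fastforce
    then have "ind D' (1::'r) = (\<lambda>_. 0)"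
      using \<phi>_inv_right[OF B.normaliser_steinberg[OF D'(1)]] zero by simp
    from fun_cong[OF this, of \<zeta>] show False using D'(2) by (simp add: ind_apply)
  qed
  moreover have "\<phi> n \<zeta> \<noteq> 0" if "A.normaliser n" "n \<eta> \<noteq> 0" for n using \<zeta> that by blast
  ultimately show ?thesis unfolding rel_def using \<eta> \<zeta>C by blast
qed

lemma rel_inverse: "diagonal_graded_iso.rel G2 c2 G1 \<phi>_inv \<zeta> \<eta> \<longleftrightarrow> rel \<eta> \<zeta>"
proof -
  interpret I: diagonal_graded_iso G2 c2 G1 c1 R \<phi>_inv by (rule inverse)
  have "(\<forall>n. B.normaliser n \<longrightarrow> (n \<zeta> \<noteq> 0 \<longleftrightarrow> \<phi>_inv n \<eta> \<noteq> 0)) \<longleftrightarrow>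
      (\<forall>n. A.normaliser n \<longrightarrow> (n \<eta> \<noteq> 0 \<longleftrightarrow> \<phi> n \<zeta> \<noteq> 0))" (is "?l \<longleftrightarrow> ?r")
  proof
    assume l: ?l
    show ?r
    proof (intro allI impI)
      fix n :: "'a \<Rightarrow> 'r" assume "A.normaliser n"
      then show "n \<eta> \<noteq> 0 \<longleftrightarrow> \<phi> n \<zeta> \<noteq> 0"
        using l[rule_format, of "\<phi> n"] normaliser_image[of n]
          \<phi>_inv_left[OF A.normaliser_steinberg, of n] by simp
    qed
  next
    assume r: ?r
    show ?l
    proof (intro allI impI)
      fix n :: "'b \<Rightarrow> 'r" assume "B.normaliser n"
      then show "n \<zeta> \<noteq> 0 \<longleftrightarrow> \<phi>_inv n \<eta> \<noteq> 0"
        using r[rule_format, of "\<phi>_inv n"] I.normaliser_image[of n]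
          \<phi>_inv_right[OF B.normaliser_steinberg, of n] by simp
    qed
  qed
  then show ?thesis unfolding rel_def I.rel_def by blast
qed

text \<open>Membership of \<open>\<zeta>\<close> in a basic open set is tested by a function on the
  other groupoid; uniqueness, continuity and multiplicativity of the correspondence all rest on this
  test.\<close>

lemma rel_ind_inv:
  assumes "rel \<eta> \<zeta>" "B.normaliser (ind E (1::'r))"
  shows "\<phi>_inv (ind E 1) \<eta> \<noteq> 0 \<longleftrightarrow> \<zeta> \<in> E"
proof -
  interpret I: diagonal_graded_iso G2 c2 G1 c1 R \<phi>_inv by (rule inverse)
  have "ind E (1::'r) \<zeta> \<noteq> 0 \<longleftrightarrow> \<phi>_inv (ind E 1) \<eta> \<noteq> 0"
    using assms rel_inverse[of \<zeta> \<eta>] unfolding I.rel_def by blast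
  then show ?thesis by simp
qed

lemma rel_unique:
  assumes "rel \<eta> \<zeta>" "rel \<eta> \<zeta>'" shows "\<zeta> = \<zeta>'"
proof (rule ccontr)
  assume "\<zeta> \<noteq> \<zeta>'"
  have C: "\<zeta> \<in> gcarrier G2" "\<zeta>' \<in> gcarrier G2" using assms by (auto simp: rel_def)
  have "openin (gtop G2) (topspace (gtop G2) - {\<zeta>'})"
    using C B.Hausdorff by (intro openin_diff) (simp_all add: closedin_Hausdorff_singleton)
  moreover have "\<zeta> \<in> topspace (gtop G2) - {\<zeta>'}" using C \<open>\<zeta> \<noteq> \<zeta>'\<close> by simp
  ultimately obtain E where "B.bisection E" and
    E: "B.normaliser (ind E (1::'r))" "\<zeta> \<in> E" "E \<subseteq> topspace (gtop G2) - {\<zeta>'}"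
    by (rule B.normaliser_basis)
  then show False using rel_ind_inv[OF assms(1) E(1)] rel_ind_inv[OF assms(2) E(1)] by blast
qed

text \<open>Composability of \<open>\<zeta>1\<close> and \<open>\<zeta>2\<close> is not yet known
  here. The indicator of the product set pulls back to a convolution of two normalisers. At the
  product of \<open>\<eta>1\<close> and \<open>\<eta>2\<close> it has a single term, as normalisers
  are injective on sources, and that term is nonzero in an integral domain.\<close>

lemma rel_product:
  assumes rel: "rel \<eta>1 \<zeta>1" "rel \<eta>2 \<zeta>2" "rel (gmult G1 \<eta>1 \<eta>2) \<zeta>" and comp: "(\<eta>1, \<eta>2) \<in> gcomp G1"
    and E1: "B.bisection E1" "B.normaliser (ind E1 (1::'r))" "\<zeta>1 \<in> E1"
    and E2: "B.bisection E2" "B.normaliser (ind E2 (1::'r))" "\<zeta>2 \<in> E2"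
  shows "\<zeta> \<in> B.set_mult E1 E2"
proof -
  interpret I: diagonal_graded_iso G2 c2 G1 c1 R \<phi>_inv by (rule inverse)
  let ?E = "B.set_mult E1 E2"
  let ?n1 = "\<phi>_inv (ind E1 1)" and ?n2 = "\<phi>_inv (ind E2 1)"
  note E1' = B.bisectionD[OF E1(1)] and E2' = B.bisectionD[OF E2(1)]
  have "c2 b = c2 \<zeta>1 + c2 \<zeta>2" if b: "b \<in> ?E" for b
  proof -
    obtain a a' where a: "b = gmult G2 a a'" "a \<in> E1" "a' \<in> E2" "gsource G2 a = grange G2 a'"
      using b unfolding B.set_mult_def by blast
    then have "c2 a = c2 \<zeta>1" "c2 a' = c2 \<zeta>2"
      using B.normaliser_degree[OF E1(2), of a \<zeta>1] B.normaliser_degree[OF E2(2), of a' \<zeta>2] E1(3) E2(3)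
      by (simp_all add: ind_apply)
    then show ?thesis using a B.c_mult[of a a'] E1'(5) E2'(5) by auto
  qed
  then have N: "B.normaliser (ind ?E (1::'r))"
    by (rule B.ind_normaliser[OF B.bisection_mult[OF E1(1) E2(1)]])
  have "conv G2 (ind E1 1) (ind E2 (1::'r)) = ind ?E 1"
    by (rule B.conv_ind[OF E1'(5) E2'(5,3)])
  then have prod: "\<phi>_inv (ind ?E 1) = conv G1 ?n1 ?n2"
    using I.conv[OF B.normaliser_steinberg[OF E1(2)] B.normaliser_steinberg[OF E2(2)]] by simp
  have nz: "?n1 \<eta>1 \<noteq> 0" "?n2 \<eta>2 \<noteq> 0"
    using rel_ind_inv[OF rel(1) E1(2)] rel_ind_inv[OF rel(2) E2(2)] E1(3) E2(3) by auto
  have "conv G1 ?n1 ?n2 (gmult G1 \<eta>1 \<eta>2) = ?n1 \<eta>1 * ?n2 \<eta>2"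
  proof (rule A.conv_at)
    fix b assume "?n2 b \<noteq> 0" "gsource G1 b = gsource G1 \<eta>2"
    then show "b = \<eta>2"
      using inj_onD[OF A.normaliser_inj(1)[OF I.normaliser_image[OF E2(2)]], of b \<eta>2] nz by simp
  qed (use comp A.comp_iff in auto)
  then have "\<phi>_inv (ind ?E 1) (gmult G1 \<eta>1 \<eta>2) \<noteq> 0" using prod nz by simp
  then show ?thesis using rel_ind_inv[OF rel(3) N] by blast
qed

text \<open>The partner \<open>\<zeta>\<close> of the product lies in the product of any
  neighbourhoods of \<open>\<zeta>1\<close> and \<open>\<zeta>2\<close>. Hausdorffness then gives
  composability first, and afterwards, with continuity of multiplication, equality with the
  product.\<close>

lemma rel_comp:
  assumes rel: "rel \<eta>1 \<zeta>1" "rel \<eta>2 \<zeta>2" and comp: "(\<eta>1, \<eta>2) \<in> gcomp G1"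
  shows "(\<zeta>1, \<zeta>2) \<in> gcomp G2" "rel (gmult G1 \<eta>1 \<eta>2) (gmult G2 \<zeta>1 \<zeta>2)"
proof -
  have C: "\<zeta>1 \<in> gcarrier G2" "\<zeta>2 \<in> gcarrier G2" using rel by (auto simp: rel_def)
  obtain \<zeta> where \<zeta>: "rel (gmult G1 \<eta>1 \<eta>2) \<zeta>" using rel_total A.comp_carrier[OF comp] by blast
  have \<zeta>C: "\<zeta> \<in> gcarrier G2" using \<zeta> by (simp add: rel_def)
  have near: "\<zeta> \<in> B.set_mult U V"
    if U: "openin (gtop G2) U" "\<zeta>1 \<in> U" and V: "openin (gtop G2) V" "\<zeta>2 \<in> V" for U V
  proof -
    obtain E1 where E1: "B.bisection E1" "B.normaliser (ind E1 (1::'r))" "\<zeta>1 \<in> E1" "E1 \<subseteq> U"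
      using B.normaliser_basis[OF U] .
    obtain E2 where E2: "B.bisection E2" "B.normaliser (ind E2 (1::'r))" "\<zeta>2 \<in> E2" "E2 \<subseteq> V"
      using B.normaliser_basis[OF V] .
    show ?thesis using rel_product[OF rel \<zeta> comp E1(1-3) E2(1-3)] E1(4) E2(4)
      unfolding B.set_mult_def by blast
  qed
  have sr: "gsource G2 \<zeta>1 = grange G2 \<zeta>2"
  proof (rule ccontr)
    assume "gsource G2 \<zeta>1 \<noteq> grange G2 \<zeta>2"
    then obtain U V where UV: "openin (gtop G2) U" "openin (gtop G2) V" "gsource G2 \<zeta>1 \<in> U"
      "grange G2 \<zeta>2 \<in> V" "disjnt U V"
      using B.Hausdorff C unfolding Hausdorff_space_def
      by (metis B.range_carrier B.source_carrier B.topspace)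
    \<comment> \<open>The product of these two neighbourhoods is empty, since sources in
      \<open>U\<close> never agree with ranges in \<open>V\<close>.\<close>
    have "\<zeta> \<in> B.set_mult {x \<in> gcarrier G2. gsource G2 x \<in> U} {x \<in> gcarrier G2. grange G2 x \<in> V}"
      using openin_continuous_map_preimage[OF B.continuous_source UV(1)]
        openin_continuous_map_preimage[OF B.continuous_range UV(2)] C UV
      by (intro near) simp_all
    then show False using UV(5) unfolding B.set_mult_def by (auto simp: disjnt_iff)
  qed
  then show comp2: "(\<zeta>1, \<zeta>2) \<in> gcomp G2" using C B.comp_iff by blast
  have "\<zeta> = gmult G2 \<zeta>1 \<zeta>2"
  proof (rule ccontr)
    assume neq: "\<zeta> \<noteq> gmult G2 \<zeta>1 \<zeta>2"
    let ?W = "topspace (gtop G2) - {\<zeta>}"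
    have W: "openin (gtop G2) ?W"
      using \<zeta>C B.Hausdorff by (intro openin_diff) (simp_all add: closedin_Hausdorff_singleton)
    obtain U V where "openin (gtop G2) U" "openin (gtop G2) V" "\<zeta>1 \<in> U" "\<zeta>2 \<in> V" "B.set_mult U V \<subseteq> ?W"
      using B.mult_neighbourhoods[OF C sr W] neq B.comp_carrier[OF comp2] by auto
    then show False using near by blast
  qed
  then show "rel (gmult G1 \<eta>1 \<eta>2) (gmult G2 \<zeta>1 \<zeta>2)" using \<zeta> by simp
qed

lemma rel_degree: "rel \<eta> \<zeta> \<Longrightarrow> c2 \<zeta> = c1 \<eta>"
proof -
  assume rel: "rel \<eta> \<zeta>"
  then have "\<eta> \<in> gcarrier G1" by (simp add: rel_def)
  then obtain E where "A.bisection E" and E: "A.normaliser (ind E (1::'r))" "\<eta> \<in> E" "E \<subseteq> gcarrier G1"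
    by (rule A.normaliser_basis[OF A.carrier_open])
  obtain g where g: "ind E (1::'r) \<in> graded_part G1 c1 g" using E(1) unfolding A.normaliser_def by blast
  then have "c1 \<eta> = g" using E(2) by (auto simp: graded_part_def)
  moreover have "\<phi> (ind E 1) \<zeta> \<noteq> 0" using rel E by (auto simp: rel_def ind_apply)
  then have "c2 \<zeta> = g" using in_graded[OF g] by (auto simp: graded_part_def)
  ultimately show ?thesis by simp
qed

text \<open>The preimage of a basic set \<open>E\<close> is the support of
  \<open>\<phi>_inv (ind E 1)\<close>, which is open.\<close>

lemma rel_continuous:
  assumes \<psi>: "\<And>\<eta>. \<eta> \<in> gcarrier G1 \<Longrightarrow> rel \<eta> (\<psi> \<eta>)"
  shows "continuous_map (gtop G1) (gtop G2) \<psi>"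
  unfolding continuous_map_def
proof (intro conjI allI impI)
  show "\<psi> \<in> topspace (gtop G1) \<rightarrow> topspace (gtop G2)" using \<psi> by (auto simp: rel_def)
  fix W assume W: "openin (gtop G2) W"
  interpret I: diagonal_graded_iso G2 c2 G1 c1 R \<phi>_inv by (rule inverse)
  show "openin (gtop G1) {x \<in> topspace (gtop G1). \<psi> x \<in> W}"
  proof (subst openin_subopen, safe)
    fix \<eta> assume \<eta>: "\<eta> \<in> topspace (gtop G1)" "\<psi> \<eta> \<in> W"
    obtain E where "B.bisection E" and E: "B.normaliser (ind E (1::'r))" "\<psi> \<eta> \<in> E" "E \<subseteq> W"
      using B.normaliser_basis[OF W \<eta>(2)] .
    let ?V = "{x. \<phi>_inv (ind E 1) x \<noteq> 0}"
    note st = A.normaliser_steinberg[OF I.normaliser_image[OF E(1)]]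
    have V: "?V \<subseteq> gcarrier G1" using A.steinberg_outside[OF st] by blast
    have eq: "x \<in> ?V \<longleftrightarrow> \<psi> x \<in> E" if "x \<in> gcarrier G1" for x
      using rel_ind_inv[OF \<psi>[OF that] E(1)] by simp
    have "openin (gtop G1) ?V" by (rule A.steinberg_supp(1)[OF st])
    moreover have "\<eta> \<in> ?V" using eq[of \<eta>] \<eta>(1) E(2) by simp
    moreover have "?V \<subseteq> {x \<in> topspace (gtop G1). \<psi> x \<in> W}"
    proof
      fix x assume x: "x \<in> ?V"
      then have "x \<in> gcarrier G1" using V by blast
      then show "x \<in> {x \<in> topspace (gtop G1). \<psi> x \<in> W}" using eq[of x] x E(3) by auto
    qed
    ultimately show "\<exists>V. openin (gtop G1) V \<and> \<eta> \<in> V \<and> V \<subseteq> {x \<in> topspace (gtop G1). \<psi> x \<in> W}"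
      by blast
  qed
qed

text \<open>Existence and uniqueness on both sides make \<open>rel\<close> the graph of a bijection,
  and continuity and composability in the reverse direction come from the same facts for
  \<open>\<phi>_inv\<close>.\<close>

lemma groupoid_iso_exists: "\<exists>\<psi>. groupoid_iso G1 G2 \<psi> \<and> (\<forall>\<eta>\<in>gcarrier G1. c2 (\<psi> \<eta>) = c1 \<eta>)"
proof -
  interpret I: diagonal_graded_iso G2 c2 G1 c1 R \<phi>_inv by (rule inverse)
  note inv = rel_inverse
  obtain \<psi> where \<psi>: "\<And>\<eta>. \<eta> \<in> gcarrier G1 \<Longrightarrow> rel \<eta> (\<psi> \<eta>)" using rel_total by metis
  obtain \<theta> where \<theta>: "\<And>\<zeta>. \<zeta> \<in> gcarrier G2 \<Longrightarrow> I.rel \<zeta> (\<theta> \<zeta>)" using I.rel_total by metis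
  have \<psi>C: "\<psi> \<eta> \<in> gcarrier G2" if "\<eta> \<in> gcarrier G1" for \<eta> using \<psi>[OF that] by (simp add: rel_def)
  have \<theta>C: "\<theta> \<zeta> \<in> gcarrier G1" if "\<zeta> \<in> gcarrier G2" for \<zeta> using \<theta>[OF that] by (simp add: I.rel_def)
  have \<theta>\<psi>: "\<theta> (\<psi> \<eta>) = \<eta>" if "\<eta> \<in> gcarrier G1" for \<eta>
    using I.rel_unique[OF \<theta>[OF \<psi>C[OF that]]] \<psi>[OF that] inv by blast
  have \<psi>\<theta>: "\<psi> (\<theta> \<zeta>) = \<zeta>" if "\<zeta> \<in> gcarrier G2" for \<zeta>
    using rel_unique[OF \<psi>[OF \<theta>C[OF that]]] \<theta>[OF that] inv by blast
  have bij: "bij_betw \<psi> (gcarrier G1) (gcarrier G2)"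
    by (rule bij_betwI[where g = \<theta>]) (use \<psi>C \<theta>C \<theta>\<psi> \<psi>\<theta> in auto)
  have "homeomorphic_maps (gtop G1) (gtop G2) \<psi> \<theta>"
    unfolding homeomorphic_maps_def
    using rel_continuous[of \<psi>] \<psi> I.rel_continuous[of \<theta>] \<theta> \<theta>\<psi> \<psi>\<theta> by simp
  then have "homeomorphic_map (gtop G1) (gtop G2) \<psi>" by (rule homeomorphic_maps_imp_map)
  moreover have "(a, b) \<in> gcomp G1 \<longleftrightarrow> (\<psi> a, \<psi> b) \<in> gcomp G2"
    if "a \<in> gcarrier G1" "b \<in> gcarrier G1" for a b
    using rel_comp(1)[OF \<psi>[OF that(1)] \<psi>[OF that(2)]]
      I.rel_comp(1)[OF inv[THEN iffD2, OF \<psi>[OF that(1)]] inv[THEN iffD2, OF \<psi>[OF that(2)]]] by blast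
  moreover have "\<psi> (gmult G1 a b) = gmult G2 (\<psi> a) (\<psi> b)" if "(a, b) \<in> gcomp G1" for a b
  proof -
    have C: "a \<in> gcarrier G1" "b \<in> gcarrier G1" "gmult G1 a b \<in> gcarrier G1"
      using A.comp_carrier[OF that] by auto
    show ?thesis using rel_unique[OF \<psi>[OF C(3)] rel_comp(2)[OF \<psi>[OF C(1)] \<psi>[OF C(2)] that]] .
  qed
  ultimately have "groupoid_iso G1 G2 \<psi>" unfolding groupoid_iso_def using bij by blast
  moreover have "\<forall>\<eta>\<in>gcarrier G1. c2 (\<psi> \<eta>) = c1 \<eta>" using rel_degree \<psi> by blast
  ultimately show ?thesis by blast
qed

end

section \<open>Pushing forward along a groupoid isomorphism\<close>

text \<open>\<open>groupoid_iso\<close> speaks of products only; characterising units as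
  idempotents, and inverses by a unit product, shows that both are preserved as well.\<close>

lemma (in gpd) idempotent_unit:
  assumes "(p, p) \<in> gcomp G" "p \<cdot> p = p" shows "p \<in> gunits G"
proof -
  have p: "p \<in> C" using assms(1) by (simp add: comp_iff)
  have "\<iota> p \<cdot> p = p" using cancel(1)[OF assms(1)] assms(2) by simp
  then show ?thesis using source_unit[OF p] by (simp add: gsource_def)
qed

lemma (in gpd) inv_unique:
  assumes "(b, a) \<in> gcomp G" "b \<cdot> a \<in> gunits G" shows "b = \<iota> a"
proof -
  have c: "b \<in> C" "a \<in> C" "s b = r a" using assms(1) by (auto simp: comp_iff)
  then have s: "s (b \<cdot> a) = r (\<iota> a)" by (simp add: source_mult)
  show ?thesis using mult_inv_cancel[OF c] unit_mult(2)[OF assms(2) _ s] c by simp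
qed

locale groupoid_isomorphism = A: ample G1 + B: ample G2
  for G1 :: "'a tgroupoid" and G2 :: "'b tgroupoid" +
  fixes \<psi> :: "'a \<Rightarrow> 'b"
  assumes iso: "groupoid_iso G1 G2 \<psi>"
begin

definition \<theta> where "\<theta> = inv_into (gcarrier G1) \<psi>"

definition push :: "('a \<Rightarrow> 'r::comm_ring_1) \<Rightarrow> 'b \<Rightarrow> 'r" where
  "push f y = (if y \<in> gcarrier G2 then f (\<theta> y) else 0)"

lemma bij: "bij_betw \<psi> (gcarrier G1) (gcarrier G2)"
  and homeo: "homeomorphic_map (gtop G1) (gtop G2) \<psi>"
  and comp_iff: "a \<in> gcarrier G1 \<Longrightarrow> b \<in> gcarrier G1 \<Longrightarrow> (a, b) \<in> gcomp G1 \<longleftrightarrow> (\<psi> a, \<psi> b) \<in> gcomp G2"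
  and mult: "(a, b) \<in> gcomp G1 \<Longrightarrow> \<psi> (gmult G1 a b) = gmult G2 (\<psi> a) (\<psi> b)"
  using iso by (auto simp: groupoid_iso_def)

lemma \<psi>_carrier: "a \<in> gcarrier G1 \<Longrightarrow> \<psi> a \<in> gcarrier G2"
  and \<theta>_carrier: "y \<in> gcarrier G2 \<Longrightarrow> \<theta> y \<in> gcarrier G1"
  and \<theta>_\<psi>: "a \<in> gcarrier G1 \<Longrightarrow> \<theta> (\<psi> a) = a"
  and \<psi>_\<theta>: "y \<in> gcarrier G2 \<Longrightarrow> \<psi> (\<theta> y) = y"
  using bij_betw_apply[OF bij] bij_betw_apply[OF bij_betw_inv_into[OF bij]]
    bij_betw_inv_into_left[OF bij] bij_betw_inv_into_right[OF bij]
  by (simp_all add: \<theta>_def)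

lemma push_\<psi>: "a \<in> gcarrier G1 \<Longrightarrow> push f (\<psi> a) = f a"
  by (simp add: push_def \<psi>_carrier \<theta>_\<psi>)

lemma inverse: "groupoid_isomorphism G2 G1 \<theta>"
proof
  have bij': "bij_betw \<theta> (gcarrier G2) (gcarrier G1)"
    unfolding \<theta>_def by (rule bij_betw_inv_into[OF bij])
  obtain g where g: "homeomorphic_maps (gtop G1) (gtop G2) \<psi> g"
    using homeo homeomorphic_map_maps by blast
  \<comment> \<open>A homeomorphism provides some continuous inverse \<open>g\<close>, which has to
    be identified with the chosen \<open>\<theta>\<close> on the carrier.\<close>
  have "\<theta> y = g y" if "y \<in> gcarrier G2" for y
  proof -
    have "\<psi> (g y) = y" "g y \<in> gcarrier G1"
      using g that by (auto simp: homeomorphic_maps_def continuous_map_def Pi_iff)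
    then show ?thesis using \<theta>_\<psi>[of "g y"] by simp
  qed
  then have "homeomorphic_maps (gtop G1) (gtop G2) \<psi> \<theta>"
    by (intro homeomorphic_maps_eq[OF g]) simp_all
  then have "homeomorphic_maps (gtop G2) (gtop G1) \<theta> \<psi>"
    by (rule homeomorphic_maps_sym[THEN iffD1])
  then have "homeomorphic_map (gtop G2) (gtop G1) \<theta>" by (rule homeomorphic_maps_imp_map)
  moreover have comp: "(a, b) \<in> gcomp G2 \<longleftrightarrow> (\<theta> a, \<theta> b) \<in> gcomp G1"
    if "a \<in> gcarrier G2" "b \<in> gcarrier G2" for a b
    using comp_iff[OF \<theta>_carrier[OF that(1)] \<theta>_carrier[OF that(2)]] that by (simp add: \<psi>_\<theta>)
  moreover have "\<theta> (gmult G2 a b) = gmult G1 (\<theta> a) (\<theta> b)" if ab: "(a, b) \<in> gcomp G2" for a b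
  proof -
    have C: "a \<in> gcarrier G2" "b \<in> gcarrier G2" using B.comp_carrier[OF ab] by auto
    then have c: "(\<theta> a, \<theta> b) \<in> gcomp G1" using comp ab by blast
    then have "gmult G2 a b = \<psi> (gmult G1 (\<theta> a) (\<theta> b))" using mult[OF c] C by (simp add: \<psi>_\<theta>)
    then show ?thesis using \<theta>_\<psi> A.comp_carrier[OF c] by simp
  qed
  ultimately show "groupoid_iso G2 G1 \<theta>" unfolding groupoid_iso_def using bij' by blast
qed

lemma \<psi>_unit: "x \<in> gunits G1 \<Longrightarrow> \<psi> x \<in> gunits G2"
proof -
  assume x: "x \<in> gunits G1"
  have c: "x \<in> gcarrier G1" using x by (rule A.unit_carrier)
  have xx: "(x, x) \<in> gcomp G1" "gmult G1 x x = x"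
    using A.range_of_unit[OF x] A.source_of_unit[OF x] A.right_unit[OF c] c by (auto simp: A.comp_iff)
  then show ?thesis using B.idempotent_unit[of "\<psi> x"] mult[OF xx(1)] comp_iff[OF c c] by simp
qed

lemma \<theta>_unit: "y \<in> gunits G2 \<Longrightarrow> \<theta> y \<in> gunits G1"
  by (rule groupoid_isomorphism.\<psi>_unit[OF inverse])

lemma \<psi>_inv: "a \<in> gcarrier G1 \<Longrightarrow> \<psi> (ginv G1 a) = ginv G2 (\<psi> a)"
proof (rule B.inv_unique)
  assume a: "a \<in> gcarrier G1"
  have c: "(ginv G1 a, a) \<in> gcomp G1" by (rule A.inv_comp[OF a])
  then show "(\<psi> (ginv G1 a), \<psi> a) \<in> gcomp G2" using comp_iff[of "ginv G1 a" a] a by simp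
  show "gmult G2 (\<psi> (ginv G1 a)) (\<psi> a) \<in> gunits G2"
    using mult[OF c] \<psi>_unit[OF A.source_unit[OF a]] by (simp add: gsource_def)
qed

lemma push_steinberg:
  assumes f: "f \<in> steinberg G1" shows "push f \<in> steinberg G2"
proof (rule B.steinbergI)
  fix v
  have "{y \<in> gcarrier G2. push f y = v} = \<psi> ` {x \<in> gcarrier G1. f x = v}"
  proof (intro equalityI subsetI)
    fix y assume "y \<in> {y \<in> gcarrier G2. push f y = v}"
    then show "y \<in> \<psi> ` {x \<in> gcarrier G1. f x = v}"
      by (intro image_eqI[of _ _ "\<theta> y"]) (auto simp: push_def \<psi>_\<theta> \<theta>_carrier)
  qed (auto simp: push_\<psi> \<psi>_carrier)
  then show "openin (gtop G2) {y \<in> gcarrier G2. push f y = v}"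
    using homeomorphic_imp_open_map[OF homeo] A.steinberg_level_open[OF f, of v]
    by (simp add: open_map_def)
next
  have "{y. push f y \<noteq> 0} = \<psi> ` {x. f x \<noteq> 0}"
  proof (intro equalityI subsetI)
    fix y assume "y \<in> {y. push f y \<noteq> 0}"
    then show "y \<in> \<psi> ` {x. f x \<noteq> 0}"
      by (intro image_eqI[of _ _ "\<theta> y"]) (simp_all add: push_def \<psi>_\<theta> split: if_splits)
  next
    fix y assume "y \<in> \<psi> ` {x. f x \<noteq> 0}"
    then obtain x where "y = \<psi> x" "f x \<noteq> 0" by blast
    moreover from this have "x \<in> gcarrier G1" using A.steinberg_outside[OF f] by blast
    ultimately show "y \<in> {y. push f y \<noteq> 0}" by (simp add: push_\<psi>)
  qed
  then show "compactin (gtop G2) {y. push f y \<noteq> 0}"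
    using image_compactin[OF A.steinberg_supp(2)[OF f] homeomorphic_imp_continuous_map[OF homeo]] by simp
qed (simp add: push_def)

text \<open>\<open>map_prod \<psi> \<psi>\<close> matches the factorisations of
  \<open>\<theta> y\<close> with those of \<open>y\<close> term by term. Infinite index sets, where
  the sum defaults to 0, are matched as well.\<close>

lemma push_conv: "push (conv G1 f g) = conv G2 (push f) (push g)"
proof
  fix y show "push (conv G1 f g) y = conv G2 (push f) (push g) y"
  proof (cases "y \<in> gcarrier G2")
    case True
    have "conv G1 f g (\<theta> y) = conv G2 (push f) (push g) y"
      unfolding conv_def
    proof (rule sum.reindex_bij_witness[where j = "map_prod \<psi> \<psi>" and i = "map_prod \<theta> \<theta>"])
      fix p assume "p \<in> {(a, b) \<in> gcomp G1. gmult G1 a b = \<theta> y \<and> f a \<noteq> 0 \<and> g b \<noteq> 0}"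
      then obtain a b where p: "p = (a, b)" "(a, b) \<in> gcomp G1" "gmult G1 a b = \<theta> y" "f a \<noteq> 0" "g b \<noteq> 0"
        by auto
      then have C: "a \<in> gcarrier G1" "b \<in> gcarrier G1" using A.comp_carrier by blast+
      have "(\<psi> a, \<psi> b) \<in> gcomp G2" using comp_iff[OF C] p(2) by blast
      moreover have "gmult G2 (\<psi> a) (\<psi> b) = y" using mult[OF p(2)] p(3) \<psi>_\<theta>[OF True] by simp
      ultimately show "map_prod \<psi> \<psi> p \<in> {(a, b) \<in> gcomp G2. gmult G2 a b = y \<and> push f a \<noteq> 0 \<and> push g b \<noteq> 0}"
        using p(1,4,5) C by (simp add: push_\<psi>)
      show "map_prod \<theta> \<theta> (map_prod \<psi> \<psi> p) = p" using p(1) C by (simp add: \<theta>_\<psi>)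
      show "(case map_prod \<psi> \<psi> p of (a, b) \<Rightarrow> push f a * push g b) = (case p of (a, b) \<Rightarrow> f a * g b)"
        using p(1) C by (simp add: push_\<psi>)
    next
      fix p assume "p \<in> {(a, b) \<in> gcomp G2. gmult G2 a b = y \<and> push f a \<noteq> 0 \<and> push g b \<noteq> 0}"
      then obtain a b where p: "p = (a, b)" "(a, b) \<in> gcomp G2" "gmult G2 a b = y" "push f a \<noteq> 0" "push g b \<noteq> 0"
        by auto
      then have C: "a \<in> gcarrier G2" "b \<in> gcarrier G2" using B.comp_carrier by blast+
      have c: "(\<theta> a, \<theta> b) \<in> gcomp G1"
        using comp_iff[OF \<theta>_carrier[OF C(1)] \<theta>_carrier[OF C(2)]] p(2) C by (simp add: \<psi>_\<theta>)
      moreover have "gmult G1 (\<theta> a) (\<theta> b) = \<theta> y"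
        using mult[OF c] p(3) C \<theta>_\<psi>[of "gmult G1 (\<theta> a) (\<theta> b)"] A.comp_carrier[OF c] by (simp add: \<psi>_\<theta>)
      ultimately show "map_prod \<theta> \<theta> p \<in> {(a, b) \<in> gcomp G1. gmult G1 a b = \<theta> y \<and> f a \<noteq> 0 \<and> g b \<noteq> 0}"
        using p(1,4,5) C by (simp add: push_def)
      show "map_prod \<psi> \<psi> (map_prod \<theta> \<theta> p) = p" using p(1) C by (simp add: \<psi>_\<theta>)
    qed
    then show ?thesis using True by (simp add: push_def)
  qed (simp add: push_def B.conv_outside)
qed

lemma pull_push:
  assumes "f \<in> steinberg G1" shows "groupoid_isomorphism.push G2 G1 \<theta> (push f) = f"
proof
  interpret I: groupoid_isomorphism G2 G1 \<theta> by (rule inverse)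
  fix x show "I.push (push f) x = f x"
  proof (cases "x \<in> gcarrier G1")
    case True
    then have "I.push (push f) (\<theta> (\<psi> x)) = push f (\<psi> x)" by (intro I.push_\<psi> \<psi>_carrier)
    then show ?thesis using True by (simp add: \<theta>_\<psi> push_\<psi>)
  qed (simp add: I.push_def A.steinberg_outside[OF assms])
qed

lemma push_pull:
  assumes "g \<in> steinberg G2" shows "push (groupoid_isomorphism.push G2 G1 \<theta> g) = g"
proof
  interpret I: groupoid_isomorphism G2 G1 \<theta> by (rule inverse)
  fix y show "push (I.push g) y = g y"
  proof (cases "y \<in> gcarrier G2")
    case True
    then show ?thesis using I.push_\<psi>[OF True, of g] by (simp add: push_def)
  qed (simp add: push_def B.steinberg_outside[OF assms])
qed

lemma push_diagonal: "f \<in> diagonal G1 \<Longrightarrow> push f \<in> diagonal G2"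
  using push_steinberg[of f] \<psi>_unit \<psi>_\<theta> unfolding diagonal_def push_def by fastforce

lemma push_graded:
  assumes c: "\<forall>\<eta>\<in>gcarrier G1. c2 (\<psi> \<eta>) = c1 \<eta>" and f: "f \<in> graded_part G1 c1 g"
  shows "push f \<in> graded_part G2 c2 g"
proof -
  have "c2 y = g" if "push f y \<noteq> 0" for y
  proof -
    have y: "y \<in> gcarrier G2" "f (\<theta> y) \<noteq> 0" using that by (auto simp: push_def split: if_splits)
    then have "c1 (\<theta> y) = g" using f by (auto simp: graded_part_def)
    then show ?thesis using c \<theta>_carrier[OF y(1)] \<psi>_\<theta>[OF y(1)] by metis
  qed
  then show ?thesis using push_steinberg f by (auto simp: graded_part_def)
qed

lemma star_algebra_iso_push: "star_algebra_iso st G1 G2 (push :: ('a \<Rightarrow> 'r::comm_ring_1) \<Rightarrow> _)"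
proof -
  interpret I: groupoid_isomorphism G2 G1 \<theta> by (rule inverse)
  have "bij_betw (push :: ('a \<Rightarrow> 'r) \<Rightarrow> _) (steinberg G1) (steinberg G2)"
    by (rule bij_betwI[where g = I.push])
      (use push_steinberg I.push_steinberg pull_push push_pull in auto)
  then have "ring_iso G1 G2 (push :: ('a \<Rightarrow> 'r) \<Rightarrow> _)"
    by (auto simp: ring_iso_def push_conv) (auto simp: push_def)
  moreover have "push (sinvol st G1 f) = sinvol st G2 (push f)" for f :: "'a \<Rightarrow> 'r"
  proof
    fix y show "push (sinvol st G1 f) y = sinvol st G2 (push f) y"
    proof (cases "y \<in> gcarrier G2")
      case True
      then show ?thesis
        using \<theta>_carrier[OF True] groupoid_isomorphism.\<psi>_inv[OF inverse True]
        by (simp add: push_def sinvol_def)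
    qed (simp add: push_def sinvol_def)
  qed
  ultimately show ?thesis by (auto simp: star_algebra_iso_def push_def)
qed

lemma diagonal_preserving_push: "diagonal_preserving G1 G2 (push :: ('a \<Rightarrow> 'r::comm_ring_1) \<Rightarrow> _)"
proof -
  interpret I: groupoid_isomorphism G2 G1 \<theta> by (rule inverse)
  have "g \<in> push ` diagonal G1" if g: "g \<in> diagonal G2" for g :: "'b \<Rightarrow> 'r"
    using push_pull[OF B.diagonal_steinberg[OF g]] I.push_diagonal[OF g] by (metis image_eqI)
  then show ?thesis unfolding diagonal_preserving_def using push_diagonal by blast
qed

lemma graded_map_push:
  assumes c: "\<forall>\<eta>\<in>gcarrier G1. c2 (\<psi> \<eta>) = c1 \<eta>"
  shows "graded_map G1 c1 G2 c2 (push :: ('a \<Rightarrow> 'r::comm_ring_1) \<Rightarrow> _)"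
proof -
  interpret I: groupoid_isomorphism G2 G1 \<theta> by (rule inverse)
  have c': "\<forall>\<eta>\<in>gcarrier G2. c1 (\<theta> \<eta>) = c2 \<eta>" using c \<theta>_carrier \<psi>_\<theta> by metis
  have "h \<in> push ` graded_part G1 c1 g" if h: "h \<in> graded_part G2 c2 g" for g and h :: "'b \<Rightarrow> 'r"
  proof -
    have "h \<in> steinberg G2" using h by (simp add: graded_part_def)
    then show ?thesis using push_pull I.push_graded[OF c' h] by (metis image_eqI)
  qed
  then show ?thesis unfolding graded_map_def using push_graded[OF c] by blast
qed

end

theorem mainTheorem1:
  fixes G1 :: "'a tgroupoid" and G2 :: "'b tgroupoid"
    and c1 :: "'a \<Rightarrow> 'c::group_add" and c2 :: "'b \<Rightarrow> 'c"
    and st :: "'r::idom \<Rightarrow> 'r"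
  assumes "ring_involution st"
    and "ample_Hausdorff_groupoid G1" and "ample_Hausdorff_groupoid G2"
    and "continuous_cocycle G1 c1" and "continuous_cocycle G2 c2"
    and "\<exists>X1. X1 \<subseteq> gunits G1 \<and> (subtopology (gtop G1) (gunits G1)) closure_of X1 = gunits G1 \<and>
            (\<forall>x\<in>X1. grpring_no_zero_div_trivial_units TYPE('r) G1 (c1 -` {0} \<inter> isotropy G1 x) x)"
    and "\<exists>X2. X2 \<subseteq> gunits G2 \<and> (subtopology (gtop G2) (gunits G2)) closure_of X2 = gunits G2 \<and>
            (\<forall>x\<in>X2. grpring_no_zero_div_trivial_units TYPE('r) G2 (c2 -` {0} \<inter> isotropy G2 x) x)"
  shows "((\<exists>\<psi>. groupoid_iso G1 G2 \<psi> \<and> (\<forall>\<eta>\<in>gcarrier G1. c2 (\<psi> \<eta>) = c1 \<eta>))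
           \<longleftrightarrow> (\<exists>\<phi> :: ('a \<Rightarrow> 'r) \<Rightarrow> ('b \<Rightarrow> 'r). star_algebra_iso st G1 G2 \<phi> \<and>
                   diagonal_preserving G1 G2 \<phi> \<and> graded_map G1 c1 G2 c2 \<phi>))
       \<and> ((\<exists>\<phi> :: ('a \<Rightarrow> 'r) \<Rightarrow> ('b \<Rightarrow> 'r). star_algebra_iso st G1 G2 \<phi> \<and>
                   diagonal_preserving G1 G2 \<phi> \<and> graded_map G1 c1 G2 c2 \<phi>)
           \<longleftrightarrow> (\<exists>\<phi> :: ('a \<Rightarrow> 'r) \<Rightarrow> ('b \<Rightarrow> 'r). ring_iso G1 G2 \<phi> \<and>
                   diagonal_preserving G1 G2 \<phi> \<and> graded_map G1 c1 G2 c2 \<phi>))"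
proof -
  have "\<exists>\<phi> :: ('a \<Rightarrow> 'r) \<Rightarrow> ('b \<Rightarrow> 'r). star_algebra_iso st G1 G2 \<phi> \<and>
      diagonal_preserving G1 G2 \<phi> \<and> graded_map G1 c1 G2 c2 \<phi>"
    if "groupoid_iso G1 G2 \<psi>" and c: "\<forall>\<eta>\<in>gcarrier G1. c2 (\<psi> \<eta>) = c1 \<eta>" for \<psi>
  proof -
    have "groupoid_isomorphism G1 G2 \<psi>"
      using assms(2,3) that(1)
      by (simp add: groupoid_isomorphism_def groupoid_isomorphism_axioms_def ample_def ample_axioms_def
          gpd_def ample_Hausdorff_groupoid_def topological_groupoid_def)
    then interpret groupoid_isomorphism G1 G2 \<psi> .
    show ?thesis using star_algebra_iso_push diagonal_preserving_push graded_map_push[OF c] by blast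
  qed
  moreover have "\<exists>\<psi>. groupoid_iso G1 G2 \<psi> \<and> (\<forall>\<eta>\<in>gcarrier G1. c2 (\<psi> \<eta>) = c1 \<eta>)"
    if "ring_iso G1 G2 \<phi>" "diagonal_preserving G1 G2 \<phi>" "graded_map G1 c1 G2 c2 \<phi>"
    for \<phi> :: "('a \<Rightarrow> 'r) \<Rightarrow> ('b \<Rightarrow> 'r)"
  proof -
    have "diagonal_graded_iso G1 c1 G2 c2 TYPE('r) \<phi>"
      using assms(2-7) that
      by (simp add: diagonal_graded_iso_def diagonal_graded_iso_axioms_def trivial_units_def
          trivial_units_axioms_def graded_ample_def graded_ample_axioms_def ample_def ample_axioms_def
          gpd_def ample_Hausdorff_groupoid_def topological_groupoid_def)
    then show ?thesis by (rule diagonal_graded_iso.groupoid_iso_exists)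
  qed
  moreover have "ring_iso G1 G2 \<phi>" if "star_algebra_iso st G1 G2 \<phi>" for \<phi> :: "('a \<Rightarrow> 'r) \<Rightarrow> ('b \<Rightarrow> 'r)"
    using that by (simp add: star_algebra_iso_def)
  ultimately show ?thesis by blast
qed

end
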